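(* Let $S=K[x_1,\ldots,x_n]$ be a standard graded polynomial ring over a field $K$ and let $I\subset S$ be a nonzero proper graded ideal all of whose associated primes are generated by linear forms. If $I$ has linear powers and $\operatorname{depth}(S/I)=0$, then $\mathrm{v}(I^k)=\alpha(I)k-1$ for all $k\geq 1$.
   Context: $S=\bigoplus_{d\ge 0}S_d$ is graded with $\deg x_i=1$. $\operatorname{Ass}(I)$ denotes the set of associated primes of $I$ (i.e. of $S/I$). For a nonzero graded ideal $I$, $\alpha(I):=\min\{\deg(f)\mid f\in I\setminus\{0\}\}$ (over homogeneous $f$). An equigenerated graded ideal $I$ (generated by homogeneous elements of a single degree) has a linear resolution if its Castelnuovo–Mumford regularity satisfies $\operatorname{reg}(I)=\alpha(I)$; $I$ has linear powers if $I^k$ has a linear resolution for all $k\ge 1$. Depth is taken with respect to the homogeneous maximal ideal of $S$. For a proper graded ideal $I$, $\mathrm{v}(I):=\min\{d\geq 0\mid \exists f\in S_d,\ \mathfrak{p}\in\operatorname{Ass}(I)\text{ with }(I:f)=\mathfrak{p}\}$, where $(I:f)=\{g\in S\mid gf\in I\}$. *)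

theory Defs
  imports
    "HOL-Library.Poly_Mapping"
    "HOL-Library.Extended_Nat"
    "Jordan_Normal_Form.Matrix_Kernel"
begin

section \<open>Ideals of a commutative ring\<close>

text \<open>An ideal of a ring \<open>R\<close> is a submodule of \<open>R\<close> over itself: \<open>ideal.subspace I\<close> says that
  \<open>I\<close> is an ideal, and \<open>ideal.span G\<close> is the ideal generated by \<open>G\<close>.\<close>

global_interpretation ideal: Modules.module "(*) :: 'a::comm_ring_1 \<Rightarrow> 'a \<Rightarrow> 'a"
  by standard (simp_all add: algebra_simps)

definition prime_ideal :: "'a::comm_ring_1 set \<Rightarrow> bool" where
  "prime_ideal P \<longleftrightarrow> ideal.subspace P \<and> P \<noteq> UNIV \<and> (\<forall>a b. a * b \<in> P \<longrightarrow> a \<in> P \<or> b \<in> P)"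

definition colon :: "'a::comm_ring_1 set \<Rightarrow> 'a \<Rightarrow> 'a set" where
  "colon I f = {g. g * f \<in> I}"

definition Ass :: "'a::comm_ring_1 set \<Rightarrow> 'a set set" where
  "Ass I = {P. prime_ideal P \<and> (\<exists>f. P = colon I f)}"

definition ideal_mult :: "'a::comm_ring_1 set \<Rightarrow> 'a set \<Rightarrow> 'a set" where
  "ideal_mult I J = ideal.span {a * b | a b. a \<in> I \<and> b \<in> J}"

primrec ideal_power :: "'a::comm_ring_1 set \<Rightarrow> nat \<Rightarrow> 'a set" where
  "ideal_power I 0 = UNIV"
| "ideal_power I (Suc k) = ideal_mult I (ideal_power I k)"


section \<open>The standard graded polynomial ring\<close>

text \<open>The variables are indexed by a finite type \<open>'n\<close>. Polynomials are finitely supported functions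
  from exponent vectors to coefficients, with the convolution product of
  \<^theory>\<open>HOL-Library.Poly_Mapping\<close>.\<close>

type_synonym ('n, 'k) mpoly = "('n \<Rightarrow>\<^sub>0 nat) \<Rightarrow>\<^sub>0 'k"

definition var :: "'n \<Rightarrow> ('n, 'k::zero_neq_one) mpoly" where
  "var i = Poly_Mapping.single (Poly_Mapping.single i 1) 1"

definition mdeg :: "('n::finite \<Rightarrow>\<^sub>0 nat) \<Rightarrow> nat" where
  "mdeg t = (\<Sum>i\<in>UNIV. Poly_Mapping.lookup t i)"

text \<open>The graded piece \<open>S\<^sub>d\<close>. The index is an integer, so that \<open>S\<^sub>d = 0\<close> for \<open>d < 0\<close>.\<close>

definition homog :: "int \<Rightarrow> ('n::finite, 'k::zero) mpoly set" where
  "homog d = {f. \<forall>t\<in>Poly_Mapping.keys f. int (mdeg t) = d}"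

definition hom_component :: "int \<Rightarrow> ('n::finite, 'k::comm_monoid_add) mpoly \<Rightarrow> ('n, 'k) mpoly" where
  "hom_component d f = (\<Sum>t\<in>{t\<in>Poly_Mapping.keys f. int (mdeg t) = d}.
     Poly_Mapping.single t (Poly_Mapping.lookup f t))"

definition graded_ideal :: "('n::finite, 'k::field) mpoly set \<Rightarrow> bool" where
  "graded_ideal I \<longleftrightarrow> ideal.subspace I \<and> (\<forall>f\<in>I. \<forall>d. hom_component d f \<in> I)"

definition max_ideal :: "('n::finite, 'k::field) mpoly set" where
  "max_ideal = ideal.span (range var)"

definition generated_by_linear_forms :: "('n::finite, 'k::field) mpoly set \<Rightarrow> bool" where
  "generated_by_linear_forms P \<longleftrightarrow> (\<exists>L \<subseteq> homog 1. P = ideal.span L)"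

definition equigenerated :: "('n::finite, 'k::field) mpoly set \<Rightarrow> bool" where
  "equigenerated I \<longleftrightarrow> (\<exists>d. \<exists>G \<subseteq> homog d. I = ideal.span G)"

text \<open>The initial degree; meaningful for nonzero graded ideals.\<close>

definition alpha :: "('n::finite, 'k::field) mpoly set \<Rightarrow> nat" where
  "alpha I = (LEAST d. \<exists>f \<in> I - {0}. f \<in> homog (int d))"

text \<open>The \<open>v\<close>-number; meaningful for proper graded ideals.\<close>

definition v_number :: "('n::finite, 'k::field) mpoly set \<Rightarrow> nat" where
  "v_number I = (LEAST d. \<exists>f \<in> homog (int d). \<exists>P \<in> Ass I. colon I f = P)"


section \<open>Depth\<close>

text \<open>Regular sequences on \<open>S/I\<close>, expressed in \<open>S\<close>: each \<open>f\<^sub>i\<close> is a nonzerodivisor on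
  \<open>S/(I, f\<^sub>0, \<dots>, f\<^bsub>i-1\<^esub>)\<close>, and \<open>S/(I, f\<^sub>0, \<dots>, f\<^bsub>r-1\<^esub>)\<close> is nonzero.\<close>

definition regular_sequence_on_quotient :: "'a::comm_ring_1 set \<Rightarrow> 'a list \<Rightarrow> bool" where
  "regular_sequence_on_quotient I fs \<longleftrightarrow>
     (\<forall>i<length fs. \<forall>g. g * fs ! i \<in> ideal.span (I \<union> set (take i fs)) \<longrightarrow>
        g \<in> ideal.span (I \<union> set (take i fs))) \<and>
     ideal.span (I \<union> set fs) \<noteq> UNIV"

text \<open>The depth of \<open>S/I\<close> with respect to the homogeneous maximal ideal.\<close>

definition depth_quotient :: "('n::finite, 'k::field) mpoly set \<Rightarrow> enat" where
  "depth_quotient I =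
     Sup {enat (length fs) | fs. set fs \<subseteq> max_ideal \<and> regular_sequence_on_quotient I fs}"


section \<open>Minimal graded free resolutions and regularity\<close>

text \<open>A graded free resolution of \<open>I\<close> is an exact sequence
  \<open>\<dots> \<longrightarrow> F\<^sub>1 \<longrightarrow> F\<^sub>0 \<longrightarrow> I \<longrightarrow> 0\<close> of homogeneous maps of degree 0 between free modules of finite rank
  \<open>F\<^sub>i = S(-a\<^bsub>i,0\<^esub>) \<oplus> \<dots> \<oplus> S(-a\<^bsub>i,b-1\<^esub>)\<close>. The shifts of \<open>F\<^sub>i\<close> form the list \<open>a i\<close>, so its rank is
  \<open>length (a i)\<close>. The matrix \<open>D (Suc i)\<close> represents the map \<open>F\<^bsub>i+1\<^esub> \<longrightarrow> F\<^sub>i\<close>, and the one-row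
  matrix \<open>D 0\<close> represents the augmentation \<open>F\<^sub>0 \<longrightarrow> I \<subseteq> S\<close>. The ranks are not required to vanish
  eventually. The resolution is minimal if the image of \<open>F\<^bsub>i+1\<^esub>\<close> lies in
  \<open>(x\<^sub>1, \<dots>, x\<^sub>n) F\<^sub>i\<close>, i.e. if all entries of \<open>D (Suc i)\<close> lie in \<open>(x\<^sub>1, \<dots>, x\<^sub>n)\<close>.\<close>

definition graded_free_resolution ::
  "('n::finite, 'k::field) mpoly set \<Rightarrow> (nat \<Rightarrow> int list) \<Rightarrow> (nat \<Rightarrow> ('n, 'k) mpoly mat) \<Rightarrow> bool" where
  "graded_free_resolution I a D \<longleftrightarrow>
     D 0 \<in> carrier_mat 1 (length (a 0)) \<and>
     (\<forall>i. D (Suc i) \<in> carrier_mat (length (a i)) (length (a (Suc i)))) \<and>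
     (\<forall>c<length (a 0). D 0 $$ (0, c) \<in> homog (a 0 ! c)) \<and>
     (\<forall>i. \<forall>r<length (a i). \<forall>c<length (a (Suc i)).
        D (Suc i) $$ (r, c) \<in> homog (a (Suc i) ! c - a i ! r)) \<and>
     I = {(D 0 *\<^sub>v w) $ 0 | w. w \<in> carrier_vec (length (a 0))} \<and>
     (\<forall>i. mat_kernel (D i) = {D (Suc i) *\<^sub>v w | w. w \<in> carrier_vec (length (a (Suc i)))})"

definition minimal_graded_free_resolution ::
  "('n::finite, 'k::field) mpoly set \<Rightarrow> (nat \<Rightarrow> int list) \<Rightarrow> (nat \<Rightarrow> ('n, 'k) mpoly mat) \<Rightarrow> bool" where
  "minimal_graded_free_resolution I a D \<longleftrightarrow>
     graded_free_resolution I a D \<and>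
     (\<forall>i. \<forall>r<length (a i). \<forall>c<length (a (Suc i)). D (Suc i) $$ (r, c) \<in> max_ideal)"

text \<open>The graded Betti number \<open>\<beta>\<^bsub>i,j\<^esub>(I)\<close> is the number of occurrences of the shift \<open>j\<close> in \<open>a i\<close> for
  a minimal graded free resolution of \<open>I\<close>, and \<open>reg I = max {j - i. \<beta>\<^bsub>i,j\<^esub>(I) \<noteq> 0}\<close>. Minimal graded
  free resolutions exist and are unique up to isomorphism, so \<open>has_regularity I r\<close> states
  \<open>reg I = r\<close>.\<close>

definition has_regularity :: "('n::finite, 'k::field) mpoly set \<Rightarrow> int \<Rightarrow> bool" where
  "has_regularity I r \<longleftrightarrow> (\<exists>a D. minimal_graded_free_resolution I a D \<and>
     (let R = {j - int i | i j. count_list (a i) j \<noteq> 0}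
      in r \<in> R \<and> (\<forall>s\<in>R. s \<le> r)))"

definition linear_resolution :: "('n::finite, 'k::field) mpoly set \<Rightarrow> bool" where
  "linear_resolution I \<longleftrightarrow> equigenerated I \<and> has_regularity I (int (alpha I))"

definition linear_powers :: "('n::finite, 'k::field) mpoly set \<Rightarrow> bool" where
  "linear_powers I \<longleftrightarrow> (\<forall>k\<ge>1. linear_resolution (ideal_power I k))"

end

theory Submission
  imports Defs
begin

text \<open>
  Write \<open>d\<close> for the initial degree of \<open>I\<close> and \<open>m\<close> for the ideal generated by all variables. Two facts
  about \<open>I\<close> itself decide the value of the \<open>v\<close>-number for all powers at once.

  The first is that \<open>S/I\<close> has a socle element of degree exactly \<open>d - 1\<close>: a homogeneous
  \<open>f \<notin> I\<close> of degree \<open>d - 1\<close> with \<open>m f \<subseteq> I\<close>. Depth zero means that every element of \<open>m\<close> is a zero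
  divisor modulo \<open>I\<close>; by prime avoidance over the finitely many maximal associated primes, \<open>m\<close> lies in
  one of them, and this gives a socle element (\<open>depth_zero_imp_socle\<close>), which may be taken
  homogeneous. Its degree cannot be smaller than \<open>d - 1\<close> because \<open>m f\<close> contains
  nonzero elements of \<open>I\<close>, and it cannot be larger because the resolution of \<open>I\<close> is linear
  (\<open>homogeneous_socle_in_ideal\<close>). Behind the last statement stands the isomorphism between the socle of
  \<open>S/I\<close> in degree \<open>e\<close> and the degree \<open>e + n\<close> part of \<open>Tor\<^sub>n(S/I, K)\<close>, whose degrees are bounded by the
  shifts of the resolution. The argument replaces the Koszul complex by a descent that
  adjoins one variable at a time (\<open>socle_descent\<close>).

  Now let \<open>g \<in> I\<close> be nonzero of degree \<open>d\<close>. Then \<open>f g\<^sup>k\<^sup>-\<^sup>1\<close> has degree \<open>k d - 1\<close>, hence lies outside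
  \<open>I\<^sup>k\<close>, whereas \<open>m f g\<^sup>k\<^sup>-\<^sup>1 \<subseteq> I\<^sup>k\<close>. Its colon ideal is a proper ideal containing \<open>m\<close>, so it is an
  associated prime of \<open>I\<^sup>k\<close>, and \<open>k d - 1\<close> is an upper bound.

  The second fact gives the lower bound. Suppose that \<open>(I\<^sup>k : h)\<close> is prime. It contains \<open>I\<close>, hence also
  an associated prime of \<open>I\<close> (\<open>associated_prime_between\<close>), hence a nonzero linear form \<open>l\<close>. As
  \<open>l h\<close> is a nonzero element of \<open>I\<^sup>k\<close>, its degree is at least \<open>k d\<close>.

  The statements on associated primes rest on the ascending chain condition for the polynomial ring,
  which Dickson's lemma gives together with leading monomials (\<open>no_infinite_ascending_chain\<close>).
\<close>

abbreviation "lookup \<equiv> Poly_Mapping.lookup"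
abbreviation "keys \<equiv> Poly_Mapping.keys"
abbreviation "single \<equiv> Poly_Mapping.single"

text \<open>As a rewrite rule, \<open>a * (b * x) = a * b * x\<close> loops together with \<open>mult.assoc\<close>.\<close>

declare ideal.scale_scale [simp del]

section \<open>A monomial order, the domain property and the ascending chain condition\<close>

definition var_list :: "'n::finite list" where
  "var_list = (SOME xs. set xs = UNIV)"

lemma set_var_list: "set (var_list :: 'n::finite list) = UNIV"
  unfolding var_list_def by (rule someI_ex) (simp add: finite_list)

text \<open>The lexicographic order along an arbitrary enumeration of the variables. Comparing lists of fixed
  length makes it a well-order for free.\<close>

definition mon_less :: "('n::finite \<Rightarrow>\<^sub>0 nat) \<Rightarrow> ('n \<Rightarrow>\<^sub>0 nat) \<Rightarrow> bool" (infix \<open>\<prec>\<close> 50) where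
  "s \<prec> t \<longleftrightarrow> (map (lookup s) var_list, map (lookup t) var_list) \<in> lex less_than"

lemma wfp_mon_less: "wfp ((\<prec>) :: ('n::finite \<Rightarrow>\<^sub>0 nat) \<Rightarrow> _)"
proof -
  have "wf (inv_image (lex less_than) (\<lambda>s::'n \<Rightarrow>\<^sub>0 nat. map (lookup s) var_list))"
    by (intro wf_inv_image wf_lex wf_less_than)
  then show ?thesis
    unfolding wfp_def by (rule back_subst[where P = wf]) (auto simp: inv_image_def mon_less_def)
qed

lemma mon_less_irrefl: "\<not> s \<prec> s"
  using wfp_mon_less[unfolded wfp_def] by (metis case_prodI mem_Collect_eq wf_irrefl)

lemma mon_less_trans: "s \<prec> t \<Longrightarrow> t \<prec> u \<Longrightarrow> s \<prec> u"
  unfolding mon_less_def using lex_transI[OF trans_less_than] by (meson transD)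

lemma mon_less_total: "s \<prec> t \<or> s = t \<or> t \<prec> s"
proof -
  have "(map (lookup s) xs, map (lookup t) xs) \<in> lex less_than
    \<or> map (lookup s) xs = map (lookup t) xs \<or> (map (lookup t) xs, map (lookup s) xs) \<in> lex less_than"
    for xs
    by (induction xs) auto
  moreover have "s = t" if "map (lookup s) var_list = map (lookup t) var_list"
    using that by (intro poly_mapping_eqI) (simp add: set_var_list)
  ultimately show ?thesis
    unfolding mon_less_def by blast
qed

lemma mon_less_add: "s \<prec> t \<Longrightarrow> u + s \<prec> u + t"
proof -
  have "(map (lookup s) xs, map (lookup t) xs) \<in> lex less_than \<Longrightarrow>
    (map (lookup (u + s)) xs, map (lookup (u + t)) xs) \<in> lex less_than" for xs
    by (induction xs) (auto simp: lookup_add)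
  then show "s \<prec> t \<Longrightarrow> u + s \<prec> u + t"
    unfolding mon_less_def by blast
qed

definition leading :: "('n::finite, 'k::zero) mpoly \<Rightarrow> ('n \<Rightarrow>\<^sub>0 nat) \<Rightarrow> bool" where
  "leading f t \<longleftrightarrow> t \<in> keys f \<and> (\<forall>s\<in>keys f. s = t \<or> s \<prec> t)"

lemma leading_exists:
  assumes "f \<noteq> 0"
  shows "\<exists>t. leading f t"
proof -
  have "finite A \<Longrightarrow> A \<noteq> {} \<Longrightarrow> \<exists>t\<in>A. \<forall>s\<in>A. s = t \<or> s \<prec> t" for A :: "('n::finite \<Rightarrow>\<^sub>0 nat) set"
  proof (induction A rule: finite_ne_induct)
    case (insert x A)
    then obtain t where t: "t \<in> A" "\<forall>s\<in>A. s = t \<or> s \<prec> t"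
      by blast
    show ?case
    proof (cases "t \<prec> x")
      case True
      then have "\<forall>s\<in>insert x A. s = x \<or> s \<prec> x"
        using t mon_less_trans[of _ t x] by auto
      then show ?thesis
        by blast
    next
      case False
      then show ?thesis
        using t mon_less_total[of x t] by auto
    qed
  qed simp
  from this[of "keys f"] show ?thesis
    using assms unfolding leading_def by auto
qed

lemma lookup_single_mult:
  fixes f :: "('n::finite, 'k::field) mpoly"
  shows "lookup (single u c * f) (u + s) = c * lookup f s"
proof -
  have "lookup (single u c * f) (u + s) =
    Sum_any (\<lambda>l. lookup (single u c) l * Sum_any (\<lambda>q. lookup f q when u + s = l + q))"
    by (simp add: lookup_mult)
  also have "\<dots> = Sum_any (\<lambda>l. (c * Sum_any (\<lambda>q. lookup f q when u + s = l + q)) when l = u)"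
    by (rule Sum_any.cong) (simp add: lookup_single when_def)
  also have "\<dots> = c * lookup f s"
    by simp
  finally show ?thesis .
qed

lemma keys_single_mult:
  fixes f :: "('n::finite, 'k::field) mpoly"
  shows "keys (single u c * f) \<subseteq> (+) u ` keys f"
  using keys_mult[of "single u c" f] by (auto split: if_splits)

text \<open>The product of the leading terms of \<open>f\<close> and \<open>g\<close> cannot cancel: every other product of monomials
  is strictly smaller. The order is needed here because the type of variables
  comes without one.\<close>

lemma mpoly_no_zero_divisors:
  fixes f g :: "('n::finite, 'k::field) mpoly"
  assumes "f \<noteq> 0" "g \<noteq> 0"
  shows "f * g \<noteq> 0"
proof -
  obtain s t where s: "leading f s" and t: "leading g t"
    using assms leading_exists by metis
  define f' where "f' = f - single s (lookup f s)"
  have f': "keys f' \<subseteq> keys f - {s}"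
    by (auto simp: f'_def in_keys_iff lookup_minus lookup_single when_def split: if_splits)
  have "s + t \<notin> keys (f' * g)"
  proof
    assume "s + t \<in> keys (f' * g)"
    then obtain a b where ab: "s + t = a + b" "a \<in> keys f'" "b \<in> keys g"
      using keys_mult by blast
    then have "a \<prec> s" "b = t \<or> b \<prec> t"
      using f' s t by (auto simp: leading_def)
    then have "a + b \<prec> s + t"
      using mon_less_add[of a s b] mon_less_add[of b t s] mon_less_trans
      by (metis add.commute)
    then show False
      using ab(1) mon_less_irrefl by metis
  qed
  then have "lookup (f' * g) (s + t) = 0"
    by (simp add: in_keys_iff)
  moreover have "f * g = single s (lookup f s) * g + f' * g"
    by (simp add: f'_def algebra_simps)
  ultimately have "lookup (f * g) (s + t) = lookup f s * lookup g t"
    by (simp add: lookup_add lookup_single_mult)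
  then show ?thesis
    using s t by (auto simp: leading_def in_keys_iff)
qed

text \<open>Passing to a subsequence once for each variable, all coordinates become nondecreasing.\<close>

lemma dickson:
  fixes t :: "nat \<Rightarrow> ('n::finite \<Rightarrow>\<^sub>0 nat)"
  shows "\<exists>i j u. i < j \<and> t j = u + t i"
proof -
  have "\<exists>r :: nat \<Rightarrow> nat. strict_mono r \<and> (\<forall>x\<in>A. mono (\<lambda>k. lookup (t (r k)) x))" if "finite A" for A :: "'n set"
    using that
  proof (induction A)
    case empty
    show ?case
      by (rule exI[of _ id]) (auto simp: strict_mono_def)
  next
    case (insert x A)
    then obtain r :: "nat \<Rightarrow> nat" where r: "strict_mono r" "\<And>x. x \<in> A \<Longrightarrow> mono (\<lambda>k. lookup (t (r k)) x)"
      by blast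
    define w where "w k = lookup (t (r k)) x" for k
    have "\<exists>q :: nat \<Rightarrow> nat. strict_mono q \<and> mono (\<lambda>k. w (q k))"
    proof -
      obtain q :: "nat \<Rightarrow> nat" where q: "strict_mono q" "monoseq (\<lambda>k. w (q k))"
        using seq_monosub by blast
      show ?thesis
      proof (cases "incseq (\<lambda>k. w (q k))")
        case True
        then show ?thesis
          using q by blast
      next
        case False
        then have dec: "decseq (\<lambda>k. w (q k))"
          using q by (simp add: monoseq_iff)
        \<comment> \<open>A nonincreasing sequence of natural numbers is constant from its minimum on.\<close>
        obtain N where N: "\<And>k. w (q N) \<le> w (q k)"
          using ex_has_least_nat[of "\<lambda>_. True" _ "\<lambda>k. w (q k)"] by blast
        have "w (q (N + k)) = w (q N)" for k
          using N[of "N + k"] decseqD[OF dec, of N "N + k"] by simp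
        moreover have "strict_mono (\<lambda>k. q (N + k))"
          using q(1) by (simp add: strict_mono_def)
        ultimately show ?thesis
          by (metis (mono_tags, lifting) monoI order_refl)
      qed
    qed
    then obtain q :: "nat \<Rightarrow> nat" where q: "strict_mono q" "mono (\<lambda>k. w (q k))"
      by blast
    have "mono (\<lambda>k. lookup (t (r (q k))) y)" if "y \<in> insert x A" for y
      using that q(2) r(2) strict_mono_mono[OF q(1)] by (auto simp: w_def mono_def)
    then show ?case
      using strict_mono_o[OF r(1) q(1)] by (intro exI[of _ "\<lambda>k. r (q k)"]) (auto simp: o_def)
  qed
  from this[of UNIV] obtain r :: "nat \<Rightarrow> nat" where r: "strict_mono r" "\<And>x. mono (\<lambda>k. lookup (t (r k)) x)"
    by auto
  have "lookup (t (r 0)) x \<le> lookup (t (r 1)) x" for x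
    using monoD[OF r(2), of 0 1] by simp
  then have "t (r 1) = (t (r 1) - t (r 0)) + t (r 0)"
    by (intro poly_mapping_eqI) (simp add: lookup_add lookup_minus)
  then show ?thesis
    using strict_monoD[OF r(1), of 0 1] by (intro exI[of _ "r 0"] exI[of _ "r 1"]) auto
qed

text \<open>Take \<open>t k\<close> to be the smallest leading monomial of an element of \<open>J (Suc k) - J k\<close>. By Dickson's lemma
  some \<open>t i\<close> divides a later \<open>t j\<close>. Cancelling the leading term of an element for \<open>j\<close> by a multiple of one
  for \<open>i\<close>, which lies in \<open>J j\<close>, leaves an element of \<open>J (Suc j) - J j\<close> with a smaller leading
  monomial.\<close>

lemma no_infinite_ascending_chain:
  fixes J :: "nat \<Rightarrow> ('n::finite, 'k::field) mpoly set"
  assumes ideals: "\<And>k. ideal.subspace (J k)" and chain: "\<And>k. J k \<subset> J (Suc k)"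
  shows False
proof -
  define N where "N k = {t. \<exists>f\<in>J (Suc k) - J k. leading f t}" for k
  have "\<exists>t\<in>N k. \<forall>u. u \<prec> t \<longrightarrow> u \<notin> N k" for k
  proof -
    obtain f where f: "f \<in> J (Suc k) - J k"
      using chain by blast
    then have "f \<noteq> 0"
      using ideals ideal.subspace_0 by auto
    then have "N k \<noteq> {}"
      using f leading_exists unfolding N_def by blast
    then show ?thesis
      using wfp_mon_less by (auto simp: wfp_iff_ex_minimal)
  qed
  then obtain t where t: "\<And>k. t k \<in> N k" "\<And>k u. u \<prec> t k \<Longrightarrow> u \<notin> N k"
    by metis
  obtain i j u where ij: "i < j" and u: "t j = u + t i"
    using dickson by metis
  obtain f g where f: "f \<in> J (Suc i)" "leading f (t i)"
    and g: "g \<in> J (Suc j) - J j" "leading g (t j)"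
    using t(1) unfolding N_def by blast
  have "J (Suc i) \<subseteq> J j"
    using ij chain lift_Suc_mono_le[of J "Suc i" j] by (meson Suc_leI psubsetE)
  then have f_j: "single u c * f \<in> J j" for c
    using f(1) ideals ideal.subspace_scale by blast
  define h where "h = g - single u (lookup g (t j) / lookup f (t i)) * f"
  have h: "h \<in> J (Suc j) - J j"
  proof -
    have "h \<in> J (Suc j)"
      unfolding h_def using ideals f_j chain g(1) by (blast intro: ideal.subspace_diff)
    moreover have "h \<notin> J j"
    proof
      assume "h \<in> J j"
      then have "h + single u (lookup g (t j) / lookup f (t i)) * f \<in> J j"
        using ideals f_j ideal.subspace_add by blast
      then show False
        using g(1) by (simp add: h_def)
    qed
    ultimately show ?thesis
      by blast
  qed
  then have "h \<noteq> 0"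
    using ideals ideal.subspace_0 by auto
  then obtain s where s: "leading h s"
    using leading_exists by blast
  have "lookup h (t j) = 0"
    using f(2) unfolding h_def u by (simp add: lookup_minus lookup_single_mult leading_def in_keys_iff)
  then have "s \<noteq> t j"
    using s by (auto simp: leading_def in_keys_iff)
  moreover have "s = t j \<or> s \<prec> t j"
  proof -
    have "keys h \<subseteq> keys g \<union> (+) u ` keys f"
      unfolding h_def by (intro order.trans[OF keys_diff] Un_mono keys_single_mult order.refl)
    then have "s \<in> keys g \<union> (+) u ` keys f"
      using s by (auto simp: leading_def)
    then consider "s \<in> keys g" | s' where "s' \<in> keys f" "s = u + s'"
      by blast
    then show ?thesis
    proof cases
      case 1
      then show ?thesis
        using g(2) by (simp add: leading_def)
    next
      case 2
      then have "s' = t i \<or> s' \<prec> t i"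
        using f(2) by (simp add: leading_def)
      then show ?thesis
        using 2(2) mon_less_add[of s' "t i" u] by (auto simp: u)
    qed
  qed
  ultimately have "s \<in> N j \<Longrightarrow> False"
    using t(2) by blast
  then show False
    using h s unfolding N_def by blast
qed

section \<open>Associated primes and zero divisors\<close>

lemma maximal_ideal_exists:
  fixes X :: "('n::finite, 'k::field) mpoly set set"
  assumes "J0 \<in> X" and "\<And>J. J \<in> X \<Longrightarrow> ideal.subspace J"
  shows "\<exists>J\<in>X. \<forall>J'\<in>X. \<not> J \<subset> J'"
proof (rule ccontr)
  assume "\<not> ?thesis"
  then obtain F where F: "\<And>J. J \<in> X \<Longrightarrow> F J \<in> X \<and> J \<subset> F J"
    by metis
  define C where "C k = (F ^^ k) J0" for k
  have Suc: "C (Suc k) = F (C k)" for k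
    by (simp add: C_def)
  have C: "C k \<in> X" for k
  proof (induction k)
    case 0
    show ?case
      using assms(1) by (simp add: C_def)
  qed (simp add: Suc F)
  show False
    by (rule no_infinite_ascending_chain[of C]) (simp_all add: C assms(2) Suc F)
qed

lemma subspace_colon:
  assumes "ideal.subspace I"
  shows "ideal.subspace (colon I f)"
proof (rule ideal.subspaceI)
  show "0 \<in> colon I f"
    using ideal.subspace_0[OF assms] by (simp add: colon_def)
  show "x + y \<in> colon I f" if "x \<in> colon I f" "y \<in> colon I f" for x y
    using ideal.subspace_add[OF assms] that by (simp add: colon_def distrib_right)
  show "c * x \<in> colon I f" if "x \<in> colon I f" for c x
    using ideal.subspace_scale[OF assms] that by (simp add: colon_def mult.assoc)
qed

lemma subset_colon: "ideal.subspace I \<Longrightarrow> I \<subseteq> colon I f"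
  using ideal.subspace_scale[of I _ f] by (auto simp: colon_def mult.commute)

text \<open>A colon ideal that is maximal among those missing a multiplicative set \<open>W\<close> is prime. With \<open>W = {1}\<close>
  this is the existence of associated primes above a given colon ideal; with \<open>W\<close> the complement of a
  prime it is the same statement in the localization at that prime.\<close>

lemma associated_prime_avoiding_multiplicative_set:
  fixes I :: "('n::finite, 'k::field) mpoly set"
  assumes I: "ideal.subspace I"
    and one: "1 \<in> W" and mult: "\<And>s t. s \<in> W \<Longrightarrow> t \<in> W \<Longrightarrow> s * t \<in> W"
    and a: "colon I a \<inter> W = {}"
  shows "\<exists>P\<in>Ass I. colon I a \<subseteq> P \<and> P \<inter> W = {}"
proof -
  define X where "X = {colon I b | b. colon I a \<subseteq> colon I b \<and> colon I b \<inter> W = {}}"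
  have "colon I a \<in> X"
    using a by (auto simp: X_def)
  moreover have "ideal.subspace J" if "J \<in> X" for J
    using that subspace_colon[OF I] by (auto simp: X_def)
  ultimately have "\<exists>J\<in>X. \<forall>J'\<in>X. \<not> J \<subset> J'"
    by (rule maximal_ideal_exists)
  then obtain J where "J \<in> X" and J_max: "\<And>J'. J' \<in> X \<Longrightarrow> \<not> J \<subset> J'"
    by blast
  then obtain b where b: "colon I a \<subseteq> colon I b" "colon I b \<inter> W = {}" and J: "J = colon I b"
    unfolding X_def by auto
  have max: "colon I c = colon I b" if "colon I b \<subseteq> colon I c" "colon I c \<inter> W = {}" for c
  proof -
    have "colon I c \<in> X"
      using that b(1) by (auto simp: X_def)
    then show ?thesis
      using J_max that(1) by (auto simp: J psubset_eq)
  qed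
  have up: "colon I b \<subseteq> colon I (r * b)" for r
    using ideal.subspace_scale[OF I, where c = r] by (auto simp: colon_def mult.left_commute[of _ r])
  have "x \<in> colon I b \<or> y \<in> colon I b" if xy: "x * y \<in> colon I b" for x y
  proof (rule ccontr)
    assume neg: "\<not> ?thesis"
    have "y \<in> colon I (x * b)"
      using xy by (simp add: colon_def ac_simps)
    then have "colon I (x * b) \<inter> W \<noteq> {}"
      using max[OF up, of x] neg by blast
    then obtain s where s: "s \<in> W" "s * (x * b) \<in> I"
      by (auto simp: colon_def)
    \<comment> \<open>Multiplying \<open>b\<close> by \<open>s \<in> W\<close> does not enlarge its colon ideal, by maximality; but \<open>x\<close> would be new.\<close>
    have "colon I (s * b) \<inter> W = {}"
      using b(2) mult s(1) by (fastforce simp: colon_def mult.assoc[symmetric])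
    then have "colon I (s * b) = colon I b"
      by (rule max[OF up])
    moreover have "x \<in> colon I (s * b)"
      using s(2) by (simp add: colon_def ac_simps)
    ultimately show False
      using neg by blast
  qed
  then have "prime_ideal (colon I b)"
    using b(2) one subspace_colon[OF I] unfolding prime_ideal_def by blast
  then have "colon I b \<in> Ass I"
    unfolding Ass_def by blast
  then show ?thesis
    using b by blast
qed

lemma associated_prime_between:
  fixes I :: "('n::finite, 'k::field) mpoly set"
  assumes I: "ideal.subspace I" and P: "prime_ideal P" and "I \<subseteq> P"
  shows "\<exists>Q\<in>Ass I. Q \<subseteq> P"
proof -
  have "\<exists>Q\<in>Ass I. colon I 1 \<subseteq> Q \<and> Q \<inter> (- P) = {}"
  proof (rule associated_prime_avoiding_multiplicative_set[OF I])
    show "1 \<in> - P"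
      using P ideal.subspace_scale[of P 1] by (force simp: prime_ideal_def)
    show "s * t \<in> - P" if "s \<in> - P" "t \<in> - P" for s t
      using that P by (auto simp: prime_ideal_def)
    show "colon I 1 \<inter> - P = {}"
      using \<open>I \<subseteq> P\<close> by (auto simp: colon_def)
  qed
  then show ?thesis
    by blast
qed

definition maximal_Ass :: "'a::comm_ring_1 set \<Rightarrow> 'a set set" where
  "maximal_Ass I = {P \<in> Ass I. \<forall>Q\<in>Ass I. \<not> P \<subset> Q}"

lemma colon_subset_maximal_Ass:
  fixes I :: "('n::finite, 'k::field) mpoly set"
  assumes I: "ideal.subspace I" and "a \<notin> I"
  shows "\<exists>P\<in>maximal_Ass I. colon I a \<subseteq> P"
proof -
  define X where "X = {P \<in> Ass I. colon I a \<subseteq> P}"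
  have "\<exists>P\<in>Ass I. colon I a \<subseteq> P \<and> P \<inter> {1} = {}"
    using assms(2) by (intro associated_prime_avoiding_multiplicative_set[OF I]) (auto simp: colon_def)
  then obtain P0 where "P0 \<in> X"
    by (auto simp: X_def)
  then have "\<exists>P\<in>X. \<forall>Q\<in>X. \<not> P \<subset> Q"
    by (rule maximal_ideal_exists) (auto simp: X_def Ass_def prime_ideal_def)
  then obtain P where P: "P \<in> X" "\<And>Q. Q \<in> X \<Longrightarrow> \<not> P \<subset> Q"
    by blast
  have "\<not> P \<subset> Q" if "Q \<in> Ass I" for Q
  proof
    assume "P \<subset> Q"
    then have "Q \<in> X"
      using P(1) that by (auto simp: X_def)
    then show False
      using P(2) \<open>P \<subset> Q\<close> by simp
  qed
  then show ?thesis
    using P(1) by (auto simp: maximal_Ass_def X_def)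
qed

lemma prime_ideal_prod:
  assumes "prime_ideal P" "finite A" "\<And>a. a \<in> A \<Longrightarrow> c a \<notin> P"
  shows "prod c A \<notin> P"
  using assms(2,3)
proof (induction A)
  case empty
  show ?case
    using assms(1) ideal.subspace_scale[of P 1] by (force simp: prime_ideal_def)
next
  case (insert x A)
  then show ?case
    using assms(1) by (auto simp: prime_ideal_def)
qed

lemma subspace_prod:
  fixes J :: "'a::comm_ring_1 set"
  assumes "ideal.subspace J" "finite A" "a \<in> A" "c a \<in> J"
  shows "prod c A \<in> J"
  using assms ideal.subspace_scale[of J "c a" "prod c (A - {a})"]
  by (simp add: prod.remove[of A a] mult.commute)

text \<open>Choose an element outside \<open>P\<close> from each member of \<open>A\<close> and multiply.\<close>

lemma element_of_other_primes:
  assumes "finite A" "prime_ideal P" "\<And>Q. Q \<in> A \<Longrightarrow> ideal.subspace Q \<and> \<not> Q \<subseteq> P"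
  shows "\<exists>c. c \<notin> P \<and> (\<forall>Q\<in>A. c \<in> Q)"
proof -
  have "\<forall>Q\<in>A. \<exists>x. x \<in> Q \<and> x \<notin> P"
    using assms(3) by blast
  then obtain c where c: "\<And>Q. Q \<in> A \<Longrightarrow> c Q \<in> Q \<and> c Q \<notin> P"
    by metis
  have "prod c A \<notin> P"
    using assms c by (intro prime_ideal_prod) auto
  moreover have "prod c A \<in> Q" if "Q \<in> A" for Q
    using that assms c by (intro subspace_prod[of Q A Q c]) auto
  ultimately show ?thesis
    by blast
qed

text \<open>If \<open>P\<^sub>k = (I : f\<^sub>k)\<close> are pairwise incomparable primes, then \<open>f\<^sub>k\<close> does not lie in
  \<open>I + (f\<^sub>0, \<dots>, f\<^bsub>k-1\<^esub>)\<close>: an element \<open>c\<close> of all earlier primes outside \<open>P\<^sub>k\<close> multiplies that ideal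
  into \<open>I\<close>, but not \<open>f\<^sub>k\<close>. So infinitely many of them would give an infinite ascending chain.\<close>

lemma finite_maximal_Ass:
  fixes I :: "('n::finite, 'k::field) mpoly set"
  assumes I: "ideal.subspace I"
  shows "finite (maximal_Ass I)"
proof (rule ccontr)
  assume "infinite (maximal_Ass I)"
  from infinite_countable_subset[OF this]
  obtain P :: "nat \<Rightarrow> _" where inj: "inj P" and "range P \<subseteq> maximal_Ass I"
    by auto
  then have P: "P k \<in> maximal_Ass I" for k
    by auto
  have prime: "prime_ideal (P k)" and "\<exists>f. P k = colon I f" for k
    using P[of k] by (auto simp: maximal_Ass_def Ass_def)
  then obtain f where f: "\<And>k. P k = colon I (f k)"
    by metis
  define J where "J k = ideal.span (I \<union> f ` {..<k})" for k
  have "f k \<notin> J k" for k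
  proof
    assume fk: "f k \<in> J k"
    have "\<exists>c. c \<notin> P k \<and> (\<forall>Q\<in>P ` {..<k}. c \<in> Q)"
    proof (rule element_of_other_primes)
      fix Q assume "Q \<in> P ` {..<k}"
      then obtain i where i: "i < k" "Q = P i"
        by blast
      then have "P i \<noteq> P k"
        using inj by (metis injD less_irrefl)
      moreover have "P k \<in> Ass I" "\<And>Q. Q \<in> Ass I \<Longrightarrow> \<not> P i \<subset> Q"
        using P[of i] P[of k] by (auto simp: maximal_Ass_def)
      ultimately show "ideal.subspace Q \<and> \<not> Q \<subseteq> P k"
        using i prime[of i] by (auto simp: prime_ideal_def)
    qed (use prime in auto)
    then obtain c where c: "c \<notin> P k" "\<And>i. i < k \<Longrightarrow> c \<in> P i"
      by blast
    have "J k \<subseteq> colon I c"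
      unfolding J_def
    proof (rule ideal.span_minimal)
      show "I \<union> f ` {..<k} \<subseteq> colon I c"
      proof
        fix x assume "x \<in> I \<union> f ` {..<k}"
        then show "x \<in> colon I c"
          using c(2) f subset_colon[OF I, of c] by (auto simp: colon_def mult.commute)
      qed
      show "ideal.subspace (colon I c)"
        using I by (rule subspace_colon)
    qed
    then show False
      using fk c(1) f[of k] by (auto simp: colon_def mult.commute)
  qed
  moreover have "f k \<in> J (Suc k)" "J k \<subseteq> J (Suc k)" for k
    unfolding J_def by (auto intro!: ideal.span_base ideal.span_mono)
  ultimately have "J k \<subset> J (Suc k)" for k
    by (metis psubsetI)
  then show False
    by (rule no_infinite_ascending_chain[of J, rotated]) (simp add: J_def)
qed

text \<open>For incomparable primes, \<open>M\<close> contains for each \<open>P\<close> an element \<open>b P\<close> lying in every prime of \<open>A\<close>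
  but \<open>P\<close>; the sum of these elements avoids all of them.\<close>

lemma incomparable_prime_avoidance:
  fixes M :: "'a::comm_ring_1 set"
  assumes "finite A" and prime: "\<And>P. P \<in> A \<Longrightarrow> prime_ideal P"
    and inc: "\<And>P Q. P \<in> A \<Longrightarrow> Q \<in> A \<Longrightarrow> Q \<subseteq> P \<Longrightarrow> Q = P"
    and M: "ideal.subspace M" "\<And>P. P \<in> A \<Longrightarrow> \<not> M \<subseteq> P"
  shows "\<exists>a\<in>M. \<forall>P\<in>A. a \<notin> P"
proof -
  have "\<exists>b. b \<in> M \<and> b \<notin> P \<and> (\<forall>Q\<in>A - {P}. b \<in> Q)" if "P \<in> A" for P
  proof -
    have "\<exists>c. c \<notin> P \<and> (\<forall>Q\<in>insert M (A - {P}). c \<in> Q)"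
    proof (rule element_of_other_primes)
      show "ideal.subspace Q \<and> \<not> Q \<subseteq> P" if "Q \<in> insert M (A - {P})" for Q
        using that M \<open>P \<in> A\<close> prime[of Q] inc[of P Q] by (auto simp: prime_ideal_def)
    qed (use \<open>finite A\<close> prime that in auto)
    then show ?thesis
      by blast
  qed
  then obtain b where b: "\<And>P. P \<in> A \<Longrightarrow> b P \<in> M \<and> b P \<notin> P \<and> (\<forall>Q\<in>A - {P}. b P \<in> Q)"
    by metis
  have "sum b A \<notin> P" if P: "P \<in> A" for P
  proof
    have sub: "ideal.subspace P"
      using prime[OF P] by (simp add: prime_ideal_def)
    assume "sum b A \<in> P"
    moreover have "sum b (A - {P}) \<in> P"
      using b P by (intro ideal.subspace_sum[OF sub]) auto
    ultimately have "sum b A - sum b (A - {P}) \<in> P"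
      using sub ideal.subspace_diff by blast
    then show False
      using b P \<open>finite A\<close> by (simp add: sum.remove[of A P])
  qed
  moreover have "sum b A \<in> M"
    using b by (intro ideal.subspace_sum[OF M(1)]) auto
  ultimately show ?thesis
    by blast
qed

text \<open>If no maximal associated prime contained the homogeneous maximal ideal, prime avoidance would give
  in it a nonzerodivisor on \<open>S/I\<close>, that is, a regular sequence of length one.\<close>

lemma depth_zero_imp_socle:
  fixes I :: "('n::finite, 'k::field) mpoly set"
  assumes I: "ideal.subspace I" "I \<subseteq> max_ideal" "(max_ideal :: ('n, 'k) mpoly set) \<noteq> UNIV"
    and depth: "depth_quotient I = 0"
  shows "\<exists>f. f \<notin> I \<and> (\<forall>i. var i * f \<in> I)"
proof -
  have "\<exists>P\<in>maximal_Ass I. max_ideal \<subseteq> P"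
  proof (rule ccontr)
    assume neg: "\<not> ?thesis"
    have "\<exists>a\<in>max_ideal. \<forall>P\<in>maximal_Ass I. a \<notin> P"
    proof (rule incomparable_prime_avoidance)
      show "ideal.subspace (max_ideal :: ('n, 'k) mpoly set)"
        by (simp add: max_ideal_def)
    qed (use neg finite_maximal_Ass[OF I(1)] in \<open>auto simp: maximal_Ass_def Ass_def\<close>)
    then obtain a where a: "a \<in> max_ideal" "\<And>P. P \<in> maximal_Ass I \<Longrightarrow> a \<notin> P"
      by blast
    have "g \<in> I" if "g * a \<in> I" for g
      using that a(2) colon_subset_maximal_Ass[OF I(1), of g] by (auto simp: colon_def mult.commute)
    moreover have "ideal.span I = I"
      using I(1) by simp
    moreover have "ideal.span (I \<union> {a}) \<noteq> UNIV"
      using I(2,3) a(1) ideal.span_minimal[of "I \<union> {a}" max_ideal] by (auto simp: max_ideal_def)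
    ultimately have "regular_sequence_on_quotient I [a]"
      by (simp add: regular_sequence_on_quotient_def del: ideal.span_eq_iff)
    then have "enat (length [a]) \<le> depth_quotient I"
      unfolding depth_quotient_def using a(1) by (intro Sup_upper) fastforce
    then show False
      using depth by (simp add: enat_0_iff)
  qed
  then obtain f where "prime_ideal (colon I f)" "max_ideal \<subseteq> colon I f"
    by (auto simp: maximal_Ass_def Ass_def)
  moreover have "var i \<in> (max_ideal :: ('n, 'k) mpoly set)" for i
    unfolding max_ideal_def by (intro ideal.span_base) auto
  moreover have "f \<notin> I" if "colon I f \<noteq> UNIV"
    using that I(1) by (auto simp: colon_def ideal.subspace_def)
  ultimately have "f \<notin> I" "var i \<in> colon I f" for i
    by (auto simp: prime_ideal_def)
  then show ?thesis
    by (auto simp: colon_def)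
qed

section \<open>Ideals generated by variables and the grading\<close>

text \<open>The ideal generated by the variables in \<open>A\<close>, described by the divisibility of monomials, so that
  calculations modulo these variables reduce to inspecting exponents.\<close>

definition var_ideal :: "'n set \<Rightarrow> ('n::finite, 'k::field) mpoly set" where
  "var_ideal A = {f. \<forall>t\<in>keys f. \<exists>i\<in>A. lookup t i \<noteq> 0}"

lemma subspace_var_ideal: "ideal.subspace (var_ideal A)"
proof (rule ideal.subspaceI)
  show "f + g \<in> var_ideal A" if "f \<in> var_ideal A" "g \<in> var_ideal A" for f g
    using that Poly_Mapping.keys_add[of f g] unfolding var_ideal_def by blast
  show "c * f \<in> var_ideal A" if f: "f \<in> var_ideal A" for c f
    unfolding var_ideal_def
  proof (intro CollectI ballI)
    fix t assume "t \<in> keys (c * f)"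
    then obtain a b where t: "t = a + b" "b \<in> keys f"
      using keys_mult[of c f] by blast
    then obtain i where "i \<in> A" "lookup b i \<noteq> 0"
      using f by (auto simp: var_ideal_def)
    then show "\<exists>i\<in>A. lookup t i \<noteq> 0"
      unfolding t by (auto simp: lookup_add)
  qed
qed (simp add: var_ideal_def)

lemma var_ideal_add [simp]: "f \<in> var_ideal A \<Longrightarrow> g \<in> var_ideal A \<Longrightarrow> f + g \<in> var_ideal A"
  using subspace_var_ideal by (rule ideal.subspace_add)

lemma var_ideal_diff [simp]: "f \<in> var_ideal A \<Longrightarrow> g \<in> var_ideal A \<Longrightarrow> f - g \<in> var_ideal A"
  using subspace_var_ideal by (rule ideal.subspace_diff)

lemma var_ideal_mult [simp]: "f \<in> var_ideal A \<Longrightarrow> c * f \<in> var_ideal A"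
  using subspace_var_ideal by (rule ideal.subspace_scale)

lemma var_ideal_mono: "A \<subseteq> B \<Longrightarrow> var_ideal A \<subseteq> var_ideal B"
  unfolding var_ideal_def by blast

lemma var_ideal_empty: "f \<in> var_ideal {} \<longleftrightarrow> f = 0"
  by (simp add: var_ideal_def)

lemma lookup_var_mult: "lookup (var i * f) (single i 1 + s) = lookup f s"
  for f :: "('n::finite, 'k::field) mpoly"
  by (simp add: var_def lookup_single_mult)

lemma keys_var_mult: "keys (var i * f) = (+) (single i 1) ` keys f"
  for f :: "('n::finite, 'k::field) mpoly"
proof
  show "keys (var i * f) \<subseteq> (+) (single i 1) ` keys f"
    unfolding var_def by (rule keys_single_mult)
  show "(+) (single i 1) ` keys f \<subseteq> keys (var i * f)"
    using lookup_var_mult[of i f] by (auto simp: in_keys_iff simp del: One_nat_def)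
qed

lemma var_mult_in_var_ideal: "i \<in> A \<Longrightarrow> var i * f \<in> var_ideal A"
  by (auto simp: var_ideal_def keys_var_mult lookup_add intro!: bexI[of _ i])

lemma var_nonzero_divisor_mod_var_ideal:
  assumes "i \<notin> A" "var i * f \<in> var_ideal A"
  shows "f \<in> var_ideal A"
proof -
  have "\<exists>j\<in>A. lookup t j \<noteq> 0" if "t \<in> keys f" for t
  proof -
    have "\<exists>j\<in>A. lookup (single i 1 + t) j \<noteq> 0"
      using assms(2) that by (auto simp: var_ideal_def keys_var_mult)
    then show ?thesis
      using assms(1) by (auto simp: lookup_add lookup_single when_def split: if_splits)
  qed
  then show ?thesis
    by (simp add: var_ideal_def)
qed

lemma var_ideal_insert_split:
  assumes "f \<in> var_ideal (insert i A)"
  shows "\<exists>g h. f = var i * g + h \<and> h \<in> var_ideal A"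
proof -
  \<comment> \<open>Divide the monomials involving \<open>i\<close> by it; the others already lie in the ideal of \<open>A\<close>.\<close>
  define T where "T = {t \<in> keys f. lookup t i \<noteq> 0}"
  define g where "g = (\<Sum>t\<in>T. single (t - single i 1) (lookup f t))"
  have "var i * g = (\<Sum>t\<in>T. single t (lookup f t))"
    unfolding g_def sum_distrib_left
  proof (rule sum.cong)
    fix t assume "t \<in> T"
    then have "single i 1 + (t - single i 1) = t"
      by (intro poly_mapping_eqI) (auto simp: T_def lookup_add lookup_minus lookup_single when_def)
    then show "var i * single (t - single i 1) (lookup f t) =
        single t (lookup f t)"
      by (simp add: var_def mult_single)
  qed simp
  then have lk: "lookup (var i * g) t = (if t \<in> T then lookup f t else 0)" for t
    by (simp add: lookup_sum lookup_single when_def T_def)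
  have "keys (f - var i * g) \<subseteq> keys f - T"
    by (auto simp: in_keys_iff lookup_minus lk split: if_splits)
  then have "f - var i * g \<in> var_ideal A"
    using assms by (auto simp: var_ideal_def T_def)
  then show ?thesis
    by (intro exI[of _ g] exI[of _ "f - var i * g"]) simp
qed

lemma max_ideal_eq_var_ideal: "(max_ideal :: ('n::finite, 'k::field) mpoly set) = var_ideal UNIV"
proof
  show "max_ideal \<subseteq> (var_ideal UNIV :: ('n, 'k) mpoly set)"
    unfolding max_ideal_def
    using var_mult_in_var_ideal[of _ UNIV 1]
    by (intro ideal.span_minimal subspace_var_ideal) auto
  have "f \<in> max_ideal" if "f \<in> var_ideal A" "finite A" for f :: "('n, 'k) mpoly" and A
    using that(2,1)
  proof (induction A arbitrary: f)
    case empty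
    then show ?case
      by (simp add: var_ideal_empty max_ideal_def ideal.span_zero)
  next
    case (insert i A)
    then obtain g h where "f = g * var i + h" "h \<in> max_ideal"
      using var_ideal_insert_split by (metis mult.commute)
    then show ?case
      unfolding max_ideal_def by (metis ideal.span_add ideal.span_scale ideal.span_base rangeI)
  qed
  then show "(var_ideal UNIV :: ('n, 'k) mpoly set) \<subseteq> max_ideal"
    by auto
qed

lemma max_ideal_proper: "(max_ideal :: ('n::finite, 'k::field) mpoly set) \<noteq> UNIV"
proof -
  have "(1 :: ('n, 'k) mpoly) \<notin> max_ideal"
    by (simp add: max_ideal_eq_var_ideal var_ideal_def)
  then show ?thesis
    by blast
qed

lemma mdeg_add: "mdeg (s + t) = mdeg s + mdeg t"
  by (simp add: mdeg_def lookup_add sum.distrib)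

lemma mdeg_single_1: "mdeg (single (i :: 'n::finite) 1) = 1"
proof -
  have "mdeg (single i 1) = (\<Sum>j\<in>UNIV. if i = j then 1 else 0)"
    by (simp add: mdeg_def lookup_single when_def)
  also have "\<dots> = 1"
    by simp
  finally show ?thesis .
qed

lemma homog_positive_in_max_ideal:
  assumes "f \<in> homog d" "0 < d"
  shows "f \<in> max_ideal"
proof -
  have "\<exists>i. lookup t i \<noteq> 0" if "t \<in> keys f" for t
  proof (rule ccontr)
    assume "\<not> ?thesis"
    then have "mdeg t = 0"
      by (simp add: mdeg_def)
    then show False
      using assms that by (auto simp: homog_def)
  qed
  then show ?thesis
    by (simp add: max_ideal_eq_var_ideal var_ideal_def)
qed

lemma homog_mult: "f \<in> homog c \<Longrightarrow> g \<in> homog d \<Longrightarrow> f * g \<in> homog (c + d)"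
  for f g :: "('n::finite, 'k::field) mpoly"
  using keys_mult[of f g] by (fastforce simp: homog_def mdeg_add)

lemma var_homog: "(var i :: ('n::finite, 'k::field) mpoly) \<in> homog 1"
  using mdeg_single_1[of i] by (simp add: homog_def var_def)

lemma lookup_hom_component: "lookup (hom_component c f) t = (if int (mdeg t) = c then lookup f t else 0)"
  by (simp add: hom_component_def lookup_sum lookup_single when_def in_keys_iff)

lemma keys_hom_component: "keys (hom_component c f) = {t \<in> keys f. int (mdeg t) = c}"
  by (auto simp: in_keys_iff lookup_hom_component split: if_splits)

lemma hom_component_homog: "hom_component c f \<in> homog c"
  by (simp add: homog_def keys_hom_component)

lemma hom_component_of_homog: "f \<in> homog c \<Longrightarrow> hom_component c f = f"
  by (intro poly_mapping_eqI) (auto simp: lookup_hom_component homog_def in_keys_iff)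

lemma hom_component_diff: "hom_component c (f - g) = hom_component c f - hom_component c g"
  for f g :: "('n::finite, 'k::field) mpoly"
  by (intro poly_mapping_eqI) (simp add: lookup_hom_component lookup_minus)

lemma hom_component_sum: "hom_component c (sum f A) = (\<Sum>a\<in>A. hom_component c (f a))"
  for f :: "'b \<Rightarrow> ('n::finite, 'k::field) mpoly"
  by (intro poly_mapping_eqI) (simp add: lookup_hom_component lookup_sum)

lemma sum_hom_components:
  fixes f :: "('n::finite, 'k::field) mpoly"
  shows "f = (\<Sum>c\<in>(\<lambda>t. int (mdeg t)) ` keys f. hom_component c f)"
  by (intro poly_mapping_eqI) (auto simp: lookup_sum lookup_hom_component in_keys_iff)

lemma hom_component_mult_homog:
  fixes f g :: "('n::finite, 'k::field) mpoly"
  assumes "g \<in> homog d"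
  shows "hom_component c (g * f) = g * hom_component (c - d) f"
proof -
  let ?C = "(\<lambda>t. int (mdeg t)) ` keys f"
  have comp: "hom_component c (g * hom_component b f) = (if b = c - d then g * hom_component b f else 0)"
    for b
  proof -
    have "g * hom_component b f \<in> homog (d + b)"
      by (intro homog_mult assms hom_component_homog)
    then show ?thesis
      unfolding homog_def by (intro poly_mapping_eqI) (force simp: lookup_hom_component in_keys_iff)
  qed
  have "hom_component c (g * f) = (\<Sum>b\<in>?C. hom_component c (g * hom_component b f))"
    by (subst sum_hom_components[of f]) (simp add: sum_distrib_left hom_component_sum)
  also have "\<dots> = (if c - d \<in> ?C then g * hom_component (c - d) f else 0)"
    by (simp add: comp)
  also have "\<dots> = g * hom_component (c - d) f"
  proof -
    have "hom_component (c - d) f = 0" if "c - d \<notin> ?C"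
      using that by (subst keys_eq_empty[symmetric]) (force simp: keys_hom_component)
    then show ?thesis
      by auto
  qed
  finally show ?thesis .
qed

lemma hom_component_var_ideal: "f \<in> var_ideal A \<Longrightarrow> hom_component c f \<in> var_ideal A"
  by (simp add: var_ideal_def keys_hom_component)

section \<open>Socle degrees from a free resolution\<close>

definition vec_var_ideal :: "'n set \<Rightarrow> nat \<Rightarrow> ('n::finite, 'k::field) mpoly vec set" where
  "vec_var_ideal A m = {v \<in> carrier_vec m. \<forall>p<m. v $ p \<in> var_ideal A}"

lemma vec_var_ideal_mono: "A \<subseteq> B \<Longrightarrow> vec_var_ideal A m \<subseteq> vec_var_ideal B m"
  using var_ideal_mono unfolding vec_var_ideal_def by blast

lemma vec_var_ideal_carrier: "v \<in> vec_var_ideal A m \<Longrightarrow> v \<in> carrier_vec m"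
  by (auto simp: vec_var_ideal_def)

lemma vec_var_ideal_add: "v \<in> vec_var_ideal A m \<Longrightarrow> w \<in> vec_var_ideal A m \<Longrightarrow> v + w \<in> vec_var_ideal A m"
  by (auto simp: vec_var_ideal_def)

lemma vec_var_ideal_diff: "v \<in> vec_var_ideal A m \<Longrightarrow> w \<in> vec_var_ideal A m \<Longrightarrow> v - w \<in> vec_var_ideal A m"
  by (auto simp: vec_var_ideal_def)

lemma vec_var_ideal_smult: "v \<in> vec_var_ideal A m \<Longrightarrow> c \<cdot>\<^sub>v v \<in> vec_var_ideal A m"
  by (auto simp: vec_var_ideal_def)

lemma vec_var_ideal_mult_mat_vec:
  assumes "M \<in> carrier_mat l m" "v \<in> vec_var_ideal A m"
  shows "M *\<^sub>v v \<in> vec_var_ideal A l"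
proof -
  have "(\<Sum>q<m. M $$ (p, q) * v $ q) \<in> var_ideal A" for p
    using assms(2) by (intro ideal.subspace_sum[OF subspace_var_ideal]) (simp add: vec_var_ideal_def)
  then show ?thesis
    using assms by (auto simp: vec_var_ideal_def scalar_prod_def atLeast0LessThan)
qed

lemma var_smult_in_vec_var_ideal:
  "i \<in> A \<Longrightarrow> v \<in> carrier_vec m \<Longrightarrow> var i \<cdot>\<^sub>v v \<in> vec_var_ideal A m"
  by (auto simp: vec_var_ideal_def var_mult_in_var_ideal)

lemma var_smult_cancel_vec_var_ideal:
  "i \<notin> A \<Longrightarrow> v \<in> carrier_vec m \<Longrightarrow> var i \<cdot>\<^sub>v v \<in> vec_var_ideal A m \<Longrightarrow> v \<in> vec_var_ideal A m"
  by (auto simp: vec_var_ideal_def intro: var_nonzero_divisor_mod_var_ideal)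

lemma vec_var_ideal_insert_split:
  assumes "v \<in> vec_var_ideal (insert i A) m"
  shows "\<exists>y\<in>carrier_vec m. \<exists>w\<in>vec_var_ideal A m. v = var i \<cdot>\<^sub>v y + w"
proof -
  have "\<forall>p<m. \<exists>g h. v $ p = var i * g + h \<and> h \<in> var_ideal A"
    using assms var_ideal_insert_split by (fastforce simp: vec_var_ideal_def)
  then obtain g h where gh: "\<And>p. p < m \<Longrightarrow> v $ p = var i * g p + h p \<and> h p \<in> var_ideal A"
    by metis
  have "v = var i \<cdot>\<^sub>v vec m g + vec m h"
    using assms gh by (intro eq_vecI) (auto simp: vec_var_ideal_def)
  moreover have "vec m h \<in> vec_var_ideal A m"
    using gh by (auto simp: vec_var_ideal_def)
  ultimately show ?thesis
    by (intro bexI[of _ "vec m g"] bexI[of _ "vec m h"]) auto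
qed

lemma vec_var_ideal_empty: "v \<in> vec_var_ideal {} m \<Longrightarrow> v = 0\<^sub>v m"
  by (intro eq_vecI) (auto simp: vec_var_ideal_def var_ideal_empty)

text \<open>A resolution of \<open>S/I\<close> rather than of \<open>I\<close>: the module in position \<open>i\<close> is free of rank \<open>r i\<close>, its
  generators have degrees \<open>b i q\<close>, and \<open>D i\<close> maps position \<open>Suc i\<close> to position \<open>i\<close>. Exactness is
  required in all positions but 0.\<close>

locale graded_exact_complex =
  fixes r :: "nat \<Rightarrow> nat"
    and b :: "nat \<Rightarrow> nat \<Rightarrow> int"
    and D :: "nat \<Rightarrow> ('n::finite, 'k::field) mpoly mat"
  assumes D_carrier: "D i \<in> carrier_mat (r i) (r (Suc i))"
    and D_homog: "p < r i \<Longrightarrow> q < r (Suc i) \<Longrightarrow> D i $$ (p, q) \<in> homog (b (Suc i) q - b i p)"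
    and D_exact: "v \<in> carrier_vec (r (Suc i)) \<Longrightarrow>
      D i *\<^sub>v v = 0\<^sub>v (r i) \<longleftrightarrow> (\<exists>w\<in>carrier_vec (r (Suc (Suc i))). v = D (Suc i) *\<^sub>v w)"
begin

lemma D_dims [simp]: "dim_row (D i) = r i" "dim_col (D i) = r (Suc i)"
  using D_carrier[of i] by auto

lemma D_mult_carrier [simp]: "v \<in> carrier_vec (r (Suc i)) \<Longrightarrow> D i *\<^sub>v v \<in> carrier_vec (r i)"
  using D_carrier by (rule mult_mat_vec_carrier)

lemma D_add: "v \<in> carrier_vec (r (Suc i)) \<Longrightarrow> w \<in> carrier_vec (r (Suc i)) \<Longrightarrow>
    D i *\<^sub>v (v + w) = D i *\<^sub>v v + D i *\<^sub>v w"
  using D_carrier by (rule mult_add_distrib_mat_vec)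

lemma D_diff: "v \<in> carrier_vec (r (Suc i)) \<Longrightarrow> w \<in> carrier_vec (r (Suc i)) \<Longrightarrow>
    D i *\<^sub>v (v - w) = D i *\<^sub>v v - D i *\<^sub>v w"
  using D_carrier by (rule mult_minus_distrib_mat_vec)

lemma D_smult: "v \<in> carrier_vec (r (Suc i)) \<Longrightarrow> D i *\<^sub>v (c \<cdot>\<^sub>v v) = c \<cdot>\<^sub>v (D i *\<^sub>v v)"
  by (intro eq_vecI) (auto simp: scalar_prod_def sum_distrib_left mult.left_commute)

lemma D_D: "w \<in> carrier_vec (r (Suc (Suc i))) \<Longrightarrow> D i *\<^sub>v (D (Suc i) *\<^sub>v w) = 0\<^sub>v (r i)"
  using D_exact[of "D (Suc i) *\<^sub>v w" i] by auto

lemma D_var_ideal: "v \<in> vec_var_ideal A (r (Suc i)) \<Longrightarrow> D i *\<^sub>v v \<in> vec_var_ideal A (r i)"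
  using D_carrier by (intro vec_var_ideal_mult_mat_vec)

text \<open>This is the vanishing of \<open>Tor\<close> in homological degrees above \<open>card A\<close> for \<open>S\<close> modulo the variables in
  \<open>A\<close>, one variable at a time. If \<open>D z = x y + h\<close> with \<open>h\<close> zero modulo \<open>A\<close>, then \<open>x D y\<close> is zero modulo
  \<open>A\<close>, hence so is \<open>D y\<close>, because \<open>x\<close> is a nonzerodivisor there. By induction \<open>y\<close> is a boundary \<open>D v\<close>
  modulo \<open>A\<close>, and subtracting \<open>x v\<close> from \<open>z\<close> leaves a cycle modulo \<open>A\<close>.\<close>

lemma cycle_mod_variables_is_boundary:
  fixes A :: "'n set"
  assumes "finite A" "card A \<le> i" "z \<in> carrier_vec (r (Suc i))" "D i *\<^sub>v z \<in> vec_var_ideal A (r i)"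
  shows "\<exists>w\<in>carrier_vec (r (Suc (Suc i))). z - D (Suc i) *\<^sub>v w \<in> vec_var_ideal A (r (Suc i))"
  using assms
proof (induction A arbitrary: i z)
  case empty
  then obtain w where w: "w \<in> carrier_vec (r (Suc (Suc i)))" "z = D (Suc i) *\<^sub>v w"
    using D_exact vec_var_ideal_empty by blast
  have "z - D (Suc i) *\<^sub>v w = 0\<^sub>v (r (Suc i))"
    using w empty(2) by simp
  then show ?case
    using w(1) by (intro bexI[of _ w]) (auto simp: vec_var_ideal_def var_ideal_empty)
next
  case (insert x A)
  obtain j where i: "i = Suc j" and j: "card A \<le> j"
    using insert.prems(1) insert.hyps by (cases i) auto
  note z = insert.prems(2)
  obtain y h where y: "y \<in> carrier_vec (r i)" and h: "h \<in> vec_var_ideal A (r i)"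
    and Dz: "D i *\<^sub>v z = var x \<cdot>\<^sub>v y + h"
    using vec_var_ideal_insert_split[OF insert.prems(3)] by blast
  note h_c = vec_var_ideal_carrier[OF h]
  have "0\<^sub>v (r j) = var x \<cdot>\<^sub>v (D j *\<^sub>v y) + D j *\<^sub>v h"
    using D_D[of z j] z y h_c unfolding i[symmetric] Dz by (simp add: D_add D_smult i)
  then have "var x \<cdot>\<^sub>v (D j *\<^sub>v y) = 0\<^sub>v (r j) - D j *\<^sub>v h"
    using y h_c by (auto simp: i vec_eq_iff eq_neg_iff_add_eq_0)
  moreover have "0\<^sub>v (r j) \<in> vec_var_ideal A (r j)"
    by (simp add: vec_var_ideal_def var_ideal_def)
  ultimately have "var x \<cdot>\<^sub>v (D j *\<^sub>v y) \<in> vec_var_ideal A (r j)"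
    using D_var_ideal[of h A j] h vec_var_ideal_diff i by metis
  then have "D j *\<^sub>v y \<in> vec_var_ideal A (r j)"
    using insert.hyps(2) y by (auto simp: i intro: var_smult_cancel_vec_var_ideal)
  then obtain v where v: "v \<in> carrier_vec (r (Suc i))" and yv: "y - D i *\<^sub>v v \<in> vec_var_ideal A (r i)"
    using insert.IH[OF j, of y] y unfolding i by blast
  have "D i *\<^sub>v (z - var x \<cdot>\<^sub>v v) = var x \<cdot>\<^sub>v (y - D i *\<^sub>v v) + h"
    using z v y h_c by (auto simp: D_diff D_smult Dz vec_eq_iff algebra_simps)
  also have "\<dots> \<in> vec_var_ideal A (r i)"
    using yv h by (intro vec_var_ideal_add vec_var_ideal_smult)
  finally obtain w where w: "w \<in> carrier_vec (r (Suc (Suc i)))"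
    "z - var x \<cdot>\<^sub>v v - D (Suc i) *\<^sub>v w \<in> vec_var_ideal A (r (Suc i))"
    using insert.IH[of i "z - var x \<cdot>\<^sub>v v"] j i z v by auto
  have "z - D (Suc i) *\<^sub>v w = (z - var x \<cdot>\<^sub>v v - D (Suc i) *\<^sub>v w) + var x \<cdot>\<^sub>v v"
    using z v w by (auto simp: vec_eq_iff)
  also have "\<dots> \<in> vec_var_ideal (insert x A) (r (Suc i))"
    using w v vec_var_ideal_mono[of A "insert x A"]
    by (intro vec_var_ideal_add var_smult_in_vec_var_ideal) auto
  finally show ?case
    using w(1) by blast
qed

definition homog_vec :: "nat \<Rightarrow> int \<Rightarrow> ('n, 'k) mpoly vec set" where
  "homog_vec i c = {v \<in> carrier_vec (r i). \<forall>p<r i. v $ p \<in> homog (c - b i p)}"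

definition vec_component :: "nat \<Rightarrow> int \<Rightarrow> ('n, 'k) mpoly vec \<Rightarrow> ('n, 'k) mpoly vec" where
  "vec_component i c v = vec (r i) (\<lambda>p. hom_component (c - b i p) (v $ p))"

lemma vec_component_carrier [simp]: "vec_component i c v \<in> carrier_vec (r i)"
  by (simp add: vec_component_def)

lemma vec_component_homog: "vec_component i c v \<in> homog_vec i c"
  by (simp add: vec_component_def homog_vec_def hom_component_homog)

lemma vec_component_of_homog: "v \<in> homog_vec i c \<Longrightarrow> vec_component i c v = v"
  by (intro eq_vecI) (auto simp: vec_component_def homog_vec_def hom_component_of_homog)

lemma vec_component_diff:
  "v \<in> carrier_vec (r i) \<Longrightarrow> w \<in> carrier_vec (r i) \<Longrightarrow>
    vec_component i c (v - w) = vec_component i c v - vec_component i c w"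
  by (intro eq_vecI) (auto simp: vec_component_def hom_component_diff)

lemma vec_component_var_ideal:
  "v \<in> vec_var_ideal A (r i) \<Longrightarrow> vec_component i c v \<in> vec_var_ideal A (r i)"
  by (auto simp: vec_component_def vec_var_ideal_def hom_component_var_ideal)

lemma vec_component_D:
  assumes "v \<in> carrier_vec (r (Suc i))"
  shows "vec_component i c (D i *\<^sub>v v) = D i *\<^sub>v vec_component (Suc i) c v"
proof (rule eq_vecI)
  fix p assume "p < dim_vec (D i *\<^sub>v vec_component (Suc i) c v)"
  then have p: "p < r i"
    using D_carrier[of i] by simp
  have "hom_component (c - b i p) (D i $$ (p, q) * v $ q) =
      D i $$ (p, q) * hom_component (c - b (Suc i) q) (v $ q)" if "q < r (Suc i)" for q
    using hom_component_mult_homog[OF D_homog[OF p that], of "c - b i p" "v $ q"] by simp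
  then show "vec_component i c (D i *\<^sub>v v) $ p = (D i *\<^sub>v vec_component (Suc i) c v) $ p"
    using p assms
    by (simp add: vec_component_def scalar_prod_def hom_component_sum row_def)
qed (use D_carrier[of i] in \<open>simp add: vec_component_def\<close>)

lemma var_smult_homog_vec: "v \<in> homog_vec i c \<Longrightarrow> var x \<cdot>\<^sub>v v \<in> homog_vec i (c + 1)"
  using homog_mult[OF var_homog] by (fastforce simp: homog_vec_def add.commute add_diff_eq)

text \<open>Let \<open>s\<close> in position \<open>card A\<close> be annihilated by all variables modulo boundaries and \<open>A\<close>. For
  \<open>x \<notin> A\<close> write \<open>x s = D v\<close> modulo \<open>A\<close>. Then \<open>v\<close> has the same property one position higher, modulo
  \<open>insert x A\<close>, and if \<open>v\<close> is zero there, then so is \<open>s\<close>: this is the connecting map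
  \<open>Tor\<^sub>i\<^sub>+\<^sub>1 \<rightarrow> Tor\<^sub>i\<close> for multiplication by \<open>x\<close>. The degree grows by one at each step. Once all
  variables are used, the bound on the degrees of the generators puts the last element into
  the homogeneous maximal ideal times the free module.\<close>

lemma socle_descent:
  assumes low: "\<And>q. q < r (card (UNIV :: 'n set)) \<Longrightarrow>
      b (card (UNIV :: 'n set)) q < e + int (card (UNIV :: 'n set))"
    and "s \<in> homog_vec (card A) (e + int (card A))"
    and "\<And>x. \<exists>v\<in>carrier_vec (r (Suc (card A))).
      var x \<cdot>\<^sub>v s - D (card A) *\<^sub>v v \<in> vec_var_ideal A (r (card A))"
  shows "\<exists>v\<in>carrier_vec (r (Suc (card A))). s - D (card A) *\<^sub>v v \<in> vec_var_ideal A (r (card A))"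
  using assms(2,3)
proof (induction "card (UNIV - A)" arbitrary: A s)
  case 0
  then have A: "A = UNIV"
    by auto
  have "s $ q \<in> var_ideal A" if "q < r (card A)" for q
    using homog_positive_in_max_ideal[of "s $ q" "e + int (card A) - b (card A) q"] 0(2) that low[of q]
    by (auto simp: A max_ideal_eq_var_ideal homog_vec_def)
  then have "s \<in> vec_var_ideal A (r (card A))"
    using 0(2) by (simp add: vec_var_ideal_def homog_vec_def)
  moreover have "D (card A) *\<^sub>v 0\<^sub>v (r (Suc (card A))) = 0\<^sub>v (r (card A))"
    using D_diff[of "0\<^sub>v (r (Suc (card A)))" "card A" "0\<^sub>v (r (Suc (card A)))"]
    by (simp add: carrier_dim_vec)
  moreover have "s - 0\<^sub>v (r (card A)) = s"
    using 0(2) by (simp add: homog_vec_def)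
  ultimately show ?case
    by (intro bexI[of _ "0\<^sub>v (r (Suc (card A)))"]) auto
next
  case (Suc k)
  have "A \<noteq> UNIV"
    using Suc.hyps(2) by auto
  then obtain x where x: "x \<notin> A"
    by blast
  define m where "m = card A"
  have card_insert: "card (insert x A) = Suc m"
    using x by (simp add: m_def)
  have s: "s \<in> homog_vec m (e + int m)" "s \<in> carrier_vec (r m)"
    using Suc.prems(1) by (auto simp: m_def homog_vec_def)
  obtain v0 where v0: "v0 \<in> carrier_vec (r (Suc m))"
    "var x \<cdot>\<^sub>v s - D m *\<^sub>v v0 \<in> vec_var_ideal A (r m)"
    using Suc.prems(2)[of x] by (auto simp: m_def)
  \<comment> \<open>Only the part of matching degree counts, and taking it keeps \<open>v\<close> homogeneous.\<close>
  define v where "v = vec_component (Suc m) (e + int (Suc m)) v0"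
  have v_c: "v \<in> carrier_vec (r (Suc m))"
    by (simp add: v_def)
  have v: "var x \<cdot>\<^sub>v s - D m *\<^sub>v v \<in> vec_var_ideal A (r m)"
  proof -
    have "var x \<cdot>\<^sub>v s \<in> homog_vec m (e + int (Suc m))"
      using var_smult_homog_vec[OF s(1)] by (simp add: ac_simps)
    then show ?thesis
      using vec_component_var_ideal[OF v0(2), of "e + int (Suc m)"] s(2) v0(1)
      by (simp add: v_def vec_component_diff vec_component_of_homog vec_component_D)
  qed
  have "\<exists>u\<in>carrier_vec (r (Suc (Suc m))).
      var y \<cdot>\<^sub>v v - D (Suc m) *\<^sub>v u \<in> vec_var_ideal (insert x A) (r (Suc m))" for y
  proof -
    obtain w where w: "w \<in> carrier_vec (r (Suc m))"
      "var y \<cdot>\<^sub>v s - D m *\<^sub>v w \<in> vec_var_ideal A (r m)"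
      using Suc.prems(2)[of y] by (auto simp: m_def)
    define z where "z = var y \<cdot>\<^sub>v v - var x \<cdot>\<^sub>v w"
    have z: "z \<in> carrier_vec (r (Suc m))"
      using v_c w(1) by (simp add: z_def)
    \<comment> \<open>The cycle condition modulo \<open>A\<close> holds because multiplications by \<open>x\<close> and \<open>y\<close> commute.\<close>
    have "D m *\<^sub>v z = var x \<cdot>\<^sub>v (var y \<cdot>\<^sub>v s - D m *\<^sub>v w) - var y \<cdot>\<^sub>v (var x \<cdot>\<^sub>v s - D m *\<^sub>v v)"
      using v_c w(1) s(2) by (auto simp: z_def D_diff D_smult vec_eq_iff algebra_simps)
    also have "\<dots> \<in> vec_var_ideal A (r m)"
      by (intro vec_var_ideal_diff vec_var_ideal_smult v w)
    finally obtain u where u: "u \<in> carrier_vec (r (Suc (Suc m)))"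
      "z - D (Suc m) *\<^sub>v u \<in> vec_var_ideal A (r (Suc m))"
      using cycle_mod_variables_is_boundary[of A m z] z by (auto simp: m_def)
    have "var y \<cdot>\<^sub>v v - D (Suc m) *\<^sub>v u = (z - D (Suc m) *\<^sub>v u) + var x \<cdot>\<^sub>v w"
      using v_c w(1) u(1) by (auto simp: z_def vec_eq_iff)
    also have "\<dots> \<in> vec_var_ideal (insert x A) (r (Suc m))"
      using u(2) w(1) vec_var_ideal_mono[of A "insert x A"]
      by (intro vec_var_ideal_add var_smult_in_vec_var_ideal) auto
    finally show ?thesis
      using u(1) by blast
  qed
  moreover have "k = card (UNIV - insert x A)"
    using Suc.hyps(2) x by (simp add: card_Diff_insert card_Diff_subset)
  moreover have "v \<in> homog_vec (Suc m) (e + int (Suc m))"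
    unfolding v_def by (rule vec_component_homog)
  ultimately have "\<exists>u\<in>carrier_vec (r (Suc (Suc m))).
      v - D (Suc m) *\<^sub>v u \<in> vec_var_ideal (insert x A) (r (Suc m))"
    using Suc.hyps(1)[of "insert x A" v] unfolding card_insert by simp
  then obtain u where u: "u \<in> carrier_vec (r (Suc (Suc m)))"
    "v - D (Suc m) *\<^sub>v u \<in> vec_var_ideal (insert x A) (r (Suc m))"
    by blast
  obtain y h where y: "y \<in> carrier_vec (r (Suc m))" and h: "h \<in> vec_var_ideal A (r (Suc m))"
    and vy: "v - D (Suc m) *\<^sub>v u = var x \<cdot>\<^sub>v y + h"
    using vec_var_ideal_insert_split[OF u(2)] by blast
  have h_c: "h \<in> carrier_vec (r (Suc m))"
    using h by (rule vec_var_ideal_carrier)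
  have "D m *\<^sub>v v = D m *\<^sub>v (v - D (Suc m) *\<^sub>v u)"
    using D_D[OF u(1)] u(1) v_c by (simp add: D_diff)
  also have "\<dots> = var x \<cdot>\<^sub>v (D m *\<^sub>v y) + D m *\<^sub>v h"
    using y h_c by (simp add: vy D_add D_smult)
  finally have Dv: "D m *\<^sub>v v = var x \<cdot>\<^sub>v (D m *\<^sub>v y) + D m *\<^sub>v h" .
  have "c \<cdot>\<^sub>v (s - p) = (c \<cdot>\<^sub>v s - (c \<cdot>\<^sub>v p + q)) + q"
    if "p \<in> carrier_vec (r m)" "q \<in> carrier_vec (r m)" for c p q
    using that s(2) by (intro eq_vecI) (auto simp: right_diff_distrib)
  then have "var x \<cdot>\<^sub>v (s - D m *\<^sub>v y) = (var x \<cdot>\<^sub>v s - D m *\<^sub>v v) + D m *\<^sub>v h"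
    unfolding Dv using y h_c by simp
  also have "\<dots> \<in> vec_var_ideal A (r m)"
    by (intro vec_var_ideal_add v D_var_ideal h)
  finally have "var x \<cdot>\<^sub>v (s - D m *\<^sub>v y) \<in> vec_var_ideal A (r m)" .
  moreover have "s - D m *\<^sub>v y \<in> carrier_vec (r m)"
    using s(2) y by simp
  ultimately have "s - D m *\<^sub>v y \<in> vec_var_ideal A (r m)"
    using x var_smult_cancel_vec_var_ideal by blast
  then show ?case
    using y unfolding m_def by blast
qed

end

text \<open>Regularity \<open>d\<close> bounds the degrees of the generators in position \<open>n\<close> of the resolution of \<open>S/I\<close> by
  \<open>d + n - 1\<close>, less than the degree \<open>e + n\<close> that the descent from a socle element of degree
  \<open>e \<ge> d\<close> reaches.\<close>

lemma homogeneous_socle_in_ideal: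
  fixes I :: "('n::finite, 'k::field) mpoly set"
  assumes reg: "has_regularity I d" and f: "f \<in> homog e" and "d \<le> e"
    and socle: "\<And>x. var x * f \<in> I"
  shows "f \<in> I"
proof -
  obtain a :: "nat \<Rightarrow> int list" and D :: "nat \<Rightarrow> ('n, 'k) mpoly mat"
    where res: "graded_free_resolution I a D"
      and reg_le: "\<And>i j. count_list (a i) j \<noteq> 0 \<Longrightarrow> j - int i \<le> d"
    using reg unfolding has_regularity_def minimal_graded_free_resolution_def Let_def by blast
  \<comment> \<open>Prepend \<open>S\<close>, with its generator in degree 0, to the resolution of \<open>I\<close>.\<close>
  define r where "r i = (case i of 0 \<Rightarrow> 1 | Suc j \<Rightarrow> length (a j))" for i
  define b where "b i q = (case i of 0 \<Rightarrow> 0 | Suc j \<Rightarrow> a j ! q)" for i q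
  have rb [simp]: "r 0 = 1" "r (Suc j) = length (a j)" "b 0 q = 0" "b (Suc j) q = a j ! q" for j q
    by (simp_all add: r_def b_def)
  have carrier: "D i \<in> carrier_mat (r i) (r (Suc i))" for i
    using res by (cases i) (auto simp: graded_free_resolution_def)
  have kernel: "mat_kernel (D i) = {D (Suc i) *\<^sub>v w | w. w \<in> carrier_vec (length (a (Suc i)))}" for i
    using res by (simp add: graded_free_resolution_def)
  have image: "I = {(D 0 *\<^sub>v w) $ 0 | w. w \<in> carrier_vec (length (a 0))}"
    using res by (simp add: graded_free_resolution_def)
  interpret graded_exact_complex r b D
  proof
    fix i
    show "D i \<in> carrier_mat (r i) (r (Suc i))"
      by (rule carrier)
    show "D i $$ (p, q) \<in> homog (b (Suc i) q - b i p)" if "p < r i" "q < r (Suc i)" for p q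
      using res that by (cases i) (auto simp: graded_free_resolution_def)
    show "D i *\<^sub>v v = 0\<^sub>v (r i) \<longleftrightarrow> (\<exists>w\<in>carrier_vec (r (Suc (Suc i))). v = D (Suc i) *\<^sub>v w)"
      if "v \<in> carrier_vec (r (Suc i))" for v
    proof -
      have "D i *\<^sub>v v = 0\<^sub>v (r i) \<longleftrightarrow> v \<in> mat_kernel (D i)"
        using that by (simp add: mat_kernel[OF carrier])
      then show ?thesis
        unfolding kernel by auto
    qed
  qed
  define s where "s = vec 1 (\<lambda>_. f)"
  obtain m where m: "card (UNIV :: 'n set) = Suc m"
    using not0_implies_Suc[of "card (UNIV :: 'n set)"] by auto
  have low: "b (card (UNIV :: 'n set)) q < e + int (card (UNIV :: 'n set))"
    if "q < r (card (UNIV :: 'n set))" for q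
    using that reg_le[of m "a m ! q"] \<open>d \<le> e\<close> by (simp add: m count_list_0_iff)
  have s: "s \<in> homog_vec 0 e"
    using f by (simp add: s_def homog_vec_def)
  have boundary: "\<exists>w\<in>carrier_vec (r (Suc 0)). var x \<cdot>\<^sub>v s - D 0 *\<^sub>v w \<in> vec_var_ideal {} (r 0)" for x
  proof -
    obtain w where "w \<in> carrier_vec (length (a 0))" "var x * f = (D 0 *\<^sub>v w) $ 0"
      using socle[of x] unfolding image by blast
    then show ?thesis
      using D_mult_carrier[of w 0]
      by (intro bexI[of _ w]) (auto simp: s_def vec_var_ideal_def var_ideal_empty)
  qed
  have "\<exists>v\<in>carrier_vec (r (Suc 0)). s - D 0 *\<^sub>v v \<in> vec_var_ideal {} (r 0)"
    using socle_descent[of e s "{}"] low s boundary by simp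
  then obtain v where v: "v \<in> carrier_vec (length (a 0))" "s - D 0 *\<^sub>v v \<in> vec_var_ideal {} 1"
    by auto
  then have "f = (D 0 *\<^sub>v v) $ 0"
    by (auto simp: s_def vec_var_ideal_def var_ideal_empty)
  then show ?thesis
    using v(1) unfolding image by blast
qed

section \<open>Powers and initial degrees\<close>

lemma ideal_mult_UNIV: "ideal.subspace I \<Longrightarrow> ideal_mult I UNIV = I"
proof
  assume I: "ideal.subspace I"
  show "ideal_mult I UNIV \<subseteq> I"
    unfolding ideal_mult_def
  proof (rule ideal.span_minimal[OF _ I])
    show "{a * b | a b. a \<in> I \<and> b \<in> UNIV} \<subseteq> I"
    proof clarify
      fix a b assume "a \<in> I"
      then show "a * b \<in> I"
        using ideal.subspace_scale[OF I, of a b] by (simp add: mult.commute)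
    qed
  qed
  show "I \<subseteq> ideal_mult I UNIV"
    unfolding ideal_mult_def
  proof
    fix x assume "x \<in> I"
    then have "x * 1 \<in> {a * b | a b. a \<in> I \<and> b \<in> UNIV}"
      by blast
    from ideal.span_base[OF this] show "x \<in> ideal.span {a * b | a b. a \<in> I \<and> b \<in> UNIV}"
      unfolding mult_1_right .
  qed
qed

lemma subspace_ideal_power: "ideal.subspace (ideal_power I k)"
  by (cases k) (simp_all add: ideal_mult_def)

lemma ideal_power_SucI: "x \<in> I \<Longrightarrow> y \<in> ideal_power I k \<Longrightarrow> x * y \<in> ideal_power I (Suc k)"
  by (auto simp: ideal_mult_def intro: ideal.span_base)

lemma power_in_ideal_power: "x \<in> I \<Longrightarrow> x ^ k \<in> ideal_power I k"
  by (induction k) (simp_all add: ideal_power_SucI del: ideal_power.simps(2))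

lemma ideal_power_mdeg_ge:
  fixes I :: "('n::finite, 'k::field) mpoly set"
  assumes "\<And>f t. f \<in> I \<Longrightarrow> t \<in> keys f \<Longrightarrow> c \<le> mdeg t"
    and "f \<in> ideal_power I k" "t \<in> keys f"
  shows "c * k \<le> mdeg t"
proof -
  \<comment> \<open>The ideals of all polynomials of order at least \<open>m\<close> form a multiplicative filtration.\<close>
  define T where "T m = {f :: ('n, 'k) mpoly. \<forall>t\<in>keys f. m \<le> mdeg t}" for m
  have mult: "f * g \<in> T (l + m)" if "f \<in> T l" "g \<in> T m" for f g l m
    unfolding T_def
  proof (intro CollectI ballI)
    fix t assume "t \<in> keys (f * g)"
    then obtain a b where "t = a + b" "a \<in> keys f" "b \<in> keys g"
      using keys_mult[of f g] by blast
    then show "l + m \<le> mdeg t"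
      using that by (auto simp: T_def mdeg_add intro: add_mono)
  qed
  have sub: "ideal.subspace (T m)" for m
  proof (rule ideal.subspaceI)
    show "f + g \<in> T m" if "f \<in> T m" "g \<in> T m" for f g
      using that Poly_Mapping.keys_add[of f g] by (auto simp: T_def)
    show "c * f \<in> T m" if "f \<in> T m" for c f
      using mult[of c 0 f m] that by (simp add: T_def)
  qed (simp add: T_def)
  have "ideal_power I k \<subseteq> T (c * k)"
  proof (induction k)
    case (Suc k)
    have "a * b \<in> T (c * Suc k)" if "a \<in> I" "b \<in> ideal_power I k" for a b
      using mult[of a c b "c * k"] Suc that assms(1) by (auto simp: T_def)
    then show ?case
      unfolding ideal_power.simps ideal_mult_def by (intro ideal.span_minimal sub) blast
  qed (simp add: T_def)
  then show ?thesis
    using assms(2,3) by (auto simp: T_def)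
qed

text \<open>A polynomial outside \<open>P\<close> is congruent modulo \<open>P\<close> to its constant term, a unit.\<close>

lemma prime_ideal_above_max_ideal:
  fixes P :: "('n::finite, 'k::field) mpoly set"
  assumes P: "ideal.subspace P" "P \<noteq> UNIV" and "max_ideal \<subseteq> P"
  shows "prime_ideal P"
  unfolding prime_ideal_def
proof (intro conjI allI impI)
  fix f g assume fg: "f * g \<in> P"
  show "f \<in> P \<or> g \<in> P"
  proof (cases "f \<in> P")
    case False
    define c where "c = lookup f 0"
    have "keys (f - single 0 c) \<subseteq> keys f - {0}"
      by (auto simp: in_keys_iff lookup_minus lookup_single c_def when_def split: if_splits)
    then have "\<exists>i. lookup t i \<noteq> 0" if "t \<in> keys (f - single 0 c)" for t
      using that by (metis Diff_iff insertI1 lookup_zero poly_mapping_eqI subsetD)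
    then have const: "f - single 0 c \<in> P"
      using assms(3) by (auto simp: max_ideal_eq_var_ideal var_ideal_def)
    have "c \<noteq> 0"
      using False const by auto
    have "f * g - g * (f - single 0 c) \<in> P"
      using P(1) fg ideal.subspace_scale[OF P(1) const] by (rule ideal.subspace_diff)
    then have "single 0 c * g \<in> P"
      by (simp add: algebra_simps)
    then have "single 0 (inverse c) * (single 0 c * g) \<in> P"
      using P(1) ideal.subspace_scale by blast
    then have "g \<in> P"
      using \<open>c \<noteq> 0\<close> by (simp add: mult.assoc[symmetric] mult_single)
    then show ?thesis ..
  qed simp
qed (use P in auto)

lemma homog_nonzero_mdeg: "f \<in> homog d \<Longrightarrow> f \<noteq> 0 \<Longrightarrow> \<exists>t\<in>keys f. int (mdeg t) = d"
  unfolding homog_def using keys_eq_empty by fastforce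

theorem theorem3p7:
  fixes I :: "('n::finite, 'k::field) mpoly set"
  assumes "graded_ideal I" and "I \<noteq> {0}" and "I \<noteq> UNIV"
    and "\<forall>P\<in>Ass I. generated_by_linear_forms P"
    and "linear_powers I"
    and "depth_quotient I = 0"
  shows "\<forall>k\<ge>1. int (v_number (ideal_power I k)) = int (alpha I) * int k - 1"
proof (intro allI impI)
  fix k :: nat
  assume "k \<ge> 1"
  then obtain k' where k': "k = Suc k'"
    by (cases k) auto
  have I: "ideal.subspace I" and graded: "\<And>f d. f \<in> I \<Longrightarrow> hom_component d f \<in> I"
    using assms(1) by (auto simp: graded_ideal_def)

  have alpha_le: "alpha I \<le> d" if "f \<in> I" "f \<noteq> 0" "f \<in> homog (int d)" for f d
    unfolding alpha_def using that by (intro Least_le) auto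
  have mdeg_ge: "alpha I \<le> mdeg t" if "f \<in> I" "t \<in> keys f" for f t
  proof (rule alpha_le[of "hom_component (int (mdeg t)) f"])
    show "hom_component (int (mdeg t)) f \<noteq> 0"
      using that(2) keys_hom_component[of "int (mdeg t)" f] by auto
  qed (use that graded hom_component_homog in auto)
  have "\<exists>g. g \<in> I - {0} \<and> g \<in> homog (int (alpha I))"
  proof -
    obtain f where f: "f \<in> I" "f \<noteq> 0"
      using assms(2) ideal.subspace_0[OF I] by blast
    then obtain t where t: "t \<in> keys f"
      using keys_eq_empty by blast
    then have "hom_component (int (mdeg t)) f \<noteq> 0"
      using keys_hom_component[of "int (mdeg t)" f] by auto
    then have "\<exists>d. \<exists>g\<in>I - {0}. g \<in> homog (int d)"
      using graded[OF f(1)] hom_component_homog by blast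
    from LeastI_ex[OF this] show ?thesis
      unfolding alpha_def by blast
  qed
  then obtain g where g: "g \<in> I" "g \<noteq> 0" "g \<in> homog (int (alpha I))"
    by blast

  have linear_le: "P \<subseteq> max_ideal" if P: "P \<in> Ass I" for P
  proof -
    obtain L where L: "L \<subseteq> homog 1" "P = ideal.span L"
      using assms(4) P by (auto simp: generated_by_linear_forms_def)
    have "L \<subseteq> max_ideal"
      using L(1) homog_positive_in_max_ideal[of _ 1] by auto
    then show ?thesis
      unfolding L(2) max_ideal_def by (rule ideal.span_minimal) simp
  qed
  have "1 \<notin> I"
    using assms(3) ideal.subspace_scale[OF I, of 1] by auto
  then obtain P where "P \<in> maximal_Ass I" "colon I 1 \<subseteq> P"
    using colon_subset_maximal_Ass[OF I] by blast
  then have "I \<subseteq> max_ideal"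
    using linear_le by (auto simp: maximal_Ass_def colon_def)
  then obtain f0 where f0: "f0 \<notin> I" "\<And>i. var i * f0 \<in> I"
    using depth_zero_imp_socle[OF I _ max_ideal_proper assms(6)] by blast

  \<comment> \<open>Some homogeneous component of the socle element lies outside \<open>I\<close>, and it is again a socle element.\<close>
  have "\<exists>t\<in>keys f0. hom_component (int (mdeg t)) f0 \<notin> I"
    using f0(1) sum_hom_components[of f0] ideal.subspace_sum[OF I, of "(\<lambda>t. int (mdeg t)) ` keys f0"]
    by (metis (no_types, lifting) imageE)
  then obtain t where t: "t \<in> keys f0" "hom_component (int (mdeg t)) f0 \<notin> I"
    by blast
  define e where "e = mdeg t"
  define f where "f = hom_component (int e) f0"
  have f: "f \<notin> I" "f \<in> homog (int e)"
    using t hom_component_homog by (auto simp: f_def e_def)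
  have socle: "var i * f \<in> I" for i
    using graded[OF f0(2)[of i], of "int e + 1"]
    by (simp add: f_def hom_component_mult_homog[OF var_homog])
  have f_nz: "f \<noteq> 0"
    using f(1) ideal.subspace_0[OF I] by blast

  have alpha: "alpha I = Suc e"
  proof (rule antisym)
    have "linear_resolution (ideal_power I 1)"
      using assms(5) unfolding linear_powers_def by (metis order_refl)
    then have "has_regularity I (int (alpha I))"
      by (simp add: linear_resolution_def ideal_mult_UNIV[OF I])
    then show "Suc e \<le> alpha I"
      using homogeneous_socle_in_ideal[OF _ f(2) _ socle] f(1) by fastforce
    \<comment> \<open>Any variable serves here; there is one because types are nonempty.\<close>
    have "var undefined * f \<in> homog (int (Suc e))"
      using homog_mult[OF var_homog f(2)] by (simp add: add.commute)
    moreover have "(var undefined :: ('n, 'k) mpoly) \<noteq> 0"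
      by (simp add: var_def flip: keys_eq_empty)
    ultimately show "alpha I \<le> Suc e"
      using alpha_le socle f_nz mpoly_no_zero_divisors by metis
  qed

  let ?J = "ideal_power I k"
  have J: "ideal.subspace ?J"
    by (rule subspace_ideal_power)
  have degree_ge: "alpha I * k \<le> d" if h: "h \<in> ?J" "h \<noteq> 0" "h \<in> homog (int d)" for h d
  proof -
    obtain t where "t \<in> keys h" "mdeg t = d"
      using homog_nonzero_mdeg[OF h(3,2)] by auto
    then show ?thesis
      using ideal_power_mdeg_ge[of I "alpha I" h k t] mdeg_ge h(1) by simp
  qed

  have "v_number ?J = alpha I * k - 1"
    unfolding v_number_def
  proof (rule Least_equality)
    have pow: "g ^ j \<in> homog (int (alpha I * j)) \<and> g ^ j \<noteq> 0" for j
    proof (induction j)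
      case 0
      show ?case
        by (simp add: homog_def mdeg_def)
    next
      case (Suc j)
      then show ?case
        using homog_mult[OF g(3), of "g ^ j"] mpoly_no_zero_divisors[OF g(2), of "g ^ j"] by simp
    qed
    define h where "h = f * g ^ k'"
    have h: "h \<in> homog (int (alpha I * k - 1))" "h \<noteq> 0"
      using homog_mult[OF f(2), of "g ^ k'"] mpoly_no_zero_divisors[OF f_nz, of "g ^ k'"] pow[of k']
      by (simp_all add: h_def k' alpha)
    have "h \<notin> ?J"
      using degree_ge[OF _ h(2,1)] by (auto simp: alpha k')
    then have "colon ?J h \<noteq> UNIV"
      by (metis (mono_tags) UNIV_I colon_def mem_Collect_eq mult_1)
    moreover have "max_ideal \<subseteq> colon ?J h"
      unfolding max_ideal_def
    proof (intro ideal.span_minimal subspace_colon J)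
      have "var i * h \<in> ?J" for i
        using ideal_power_SucI[OF socle[of i] power_in_ideal_power[OF g(1), of k']]
        by (simp add: h_def k' mult.assoc)
      then show "range var \<subseteq> colon ?J h"
        by (auto simp: colon_def)
    qed
    ultimately have "colon ?J h \<in> Ass ?J"
      using prime_ideal_above_max_ideal subspace_colon[OF J] by (auto simp: Ass_def)
    then show "\<exists>h\<in>homog (int (alpha I * k - 1)). \<exists>P\<in>Ass ?J. colon ?J h = P"
      using h(1) by blast
  next
    fix d
    assume "\<exists>h\<in>homog (int d). \<exists>P\<in>Ass ?J. colon ?J h = P"
    then obtain h where h: "h \<in> homog (int d)" and P: "prime_ideal (colon ?J h)"
      by (auto simp: Ass_def)
    have "h \<noteq> 0"
      using P ideal.subspace_0[OF J] by (auto simp: prime_ideal_def colon_def)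
    have "I \<subseteq> colon ?J h"
    proof
      fix x assume "x \<in> I"
      then have "x ^ k \<in> colon ?J h"
        using power_in_ideal_power subset_colon[OF J] by blast
      then show "x \<in> colon ?J h"
        using prime_ideal_prod[OF P, of "{..<k}" "\<lambda>_. x"] by auto
    qed
    then obtain Q where Q: "Q \<in> Ass I" "Q \<subseteq> colon ?J h"
      using associated_prime_between[OF I P] by blast
    obtain L where L: "L \<subseteq> homog 1" "Q = ideal.span L"
      using assms(4) Q(1) by (auto simp: generated_by_linear_forms_def)
    have "I \<subseteq> Q"
      using Q(1) subset_colon[OF I] by (auto simp: Ass_def)
    have "\<not> L \<subseteq> {0}"
    proof
      assume "L \<subseteq> {0}"
      then have "Q \<subseteq> {0}"
        unfolding L(2) by (intro ideal.span_minimal) auto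
      then show False
        using \<open>I \<subseteq> Q\<close> assms(2) ideal.subspace_0[OF I] by blast
    qed
    then obtain l where l: "l \<in> L" "l \<noteq> 0"
      by blast
    have "l * h \<in> ?J"
      using l(1) Q(2) L(2) ideal.span_base[of l L] by (auto simp: colon_def)
    moreover have "l * h \<in> homog (int (Suc d))"
      using homog_mult[of l 1 h "int d"] l(1) L(1) h by auto
    ultimately have "alpha I * k \<le> Suc d"
      using degree_ge mpoly_no_zero_divisors[OF l(2) \<open>h \<noteq> 0\<close>] by blast
    then show "alpha I * k - 1 \<le> d"
      by simp
  qed
  then show "int (v_number ?J) = int (alpha I) * int k - 1"
    by (simp add: alpha k' algebra_simps)
qed

end
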